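(* Let $\Gamma\subset\mathbb{N}_0^s$, $\Lambda\subset\mathbb{C}^s$, and let $S_{\{\mathbf a^{[k]},\,k\ge 0\}}$ be a convergent subdivision scheme with dilation matrix $M$, $m=|\det M|$, and symbols $a^{[k]}(\boldsymbol z)$, $k\ge 0$. The scheme reproduces $EP_{\Gamma,\Lambda}$ if there exists a shift parameter $\boldsymbol\tau\in\mathbb{R}^s$ such that for all $k\ge 0$, all $\boldsymbol\gamma\in\Gamma$, all $\boldsymbol\lambda\in\Lambda$ and all $\boldsymbol\epsilon\in\Xi$, with $\mathbf v=(v_1,\dots,v_s)^T$, $v_j=\epsilon_j\, e^{-(\boldsymbol\lambda^T M^{-(k+1)})_j}$, $$ \mathbf v^{\boldsymbol\gamma} D^{\boldsymbol\gamma} a^{[k]}(\mathbf v)=\begin{cases} m\cdot \mathbf v^{M\boldsymbol\tau-\boldsymbol\tau}\, q_{\boldsymbol\gamma}(M\boldsymbol\tau-\boldsymbol\tau), & \text{if } \boldsymbol\epsilon=\mathbf 1=(1,\dots,1)^T,\\ 0, & \text{otherwise.}\end{cases} $$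
   Context: Scheme. $M\in\mathbb{Z}^{s\times s}$ has all eigenvalues greater than $1$ in absolute value. For each $k\ge 0$ the mask $\mathbf a^{[k]}=\{a^{[k]}_{\boldsymbol\alpha}:\boldsymbol\alpha\in\mathbb{Z}^s\}$ is a real sequence supported in $[0,N_k]^s$ for some positive integer $N_k$, with symbol $a^{[k]}(\boldsymbol z)=\sum_{\boldsymbol\alpha\in\mathbb{Z}^s} a^{[k]}_{\boldsymbol\alpha}\boldsymbol z^{\boldsymbol\alpha}$, $\boldsymbol z\in(\mathbb{C}\setminus\{0\})^s$. The subdivision operator is $(S_{\mathbf a^{[k]}}\mathbf f)_{\boldsymbol\alpha}=\sum_{\boldsymbol\beta\in\mathbb{Z}^s}a^{[k]}_{\boldsymbol\alpha-M\boldsymbol\beta}f_{\boldsymbol\beta}$. The scheme $S_{\{\mathbf a^{[k]},k\ge 0\}}$ maps initial data $\mathbf f^{[0]}$ on $\mathbb{Z}^s$ to the sequences $\mathbf f^{[k+1]}=S_{\mathbf a^{[k]}}\mathbf f^{[k]}$, $k\ge 0$. Parametrization and convergence. For $\boldsymbol\tau\in\mathbb{R}^s$ (the shift parameter) let $\mathbf t^{[k]}_{\boldsymbol\alpha}=M^{-k}(\boldsymbol\alpha+\boldsymbol\tau)$. Let $F^{[k]}$ be a continuous function with $F^{[k]}(\mathbf t^{[k]}_{\boldsymbol\alpha})=f^{[k]}_{\boldsymbol\alpha}$ for all $\boldsymbol\alpha$ (for definiteness, the multilinear interpolant on $\mathbb{Z}^s$ transported by $\boldsymbol x\mapsto M^{-k}(\boldsymbol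 x+\boldsymbol\tau)$). The scheme is convergent if for every initial data $\mathbf f^{[0]}$ there is a continuous limit function $g_{\mathbf f^{[0]}}$, nonzero for at least one $\mathbf f^{[0]}$, such that $F^{[k]}\to g_{\mathbf f^{[0]}}$ uniformly on compact sets. Exponential polynomials and reproduction. $EP_{\Gamma,\Lambda}=\mathrm{span}\{\boldsymbol x^{\boldsymbol\gamma}e^{\boldsymbol\lambda\cdot\boldsymbol x}:\boldsymbol\gamma\in\Gamma,\boldsymbol\lambda\in\Lambda\}$. The scheme reproduces $EP_{\Gamma,\Lambda}$ if there exists $\boldsymbol\tau\in\mathbb{R}^s$ such that for every $p\in EP_{\Gamma,\Lambda}$ and every $\ell\ge 0$, with $\mathbf f^{[\ell]}=\{p(\mathbf t^{[\ell]}_{\boldsymbol\alpha}):\boldsymbol\alpha\in\mathbb{Z}^s\}$, one has $\lim_{k\to\infty}S_{\mathbf a^{[\ell+k]}}\cdots S_{\mathbf a^{[\ell]}}\mathbf f^{[\ell]}=p$, where the sequence $S_{\mathbf a^{[\ell+k]}}\cdots S_{\mathbf a^{[\ell]}}\mathbf f^{[\ell]}$ is attached to the points $\mathbf t^{[\ell+k+1]}_{\boldsymbol\alpha}$ and the limit is in the sense of convergence above. Other notation. $\Xi=\{e^{2\pi i M^{-T}\boldsymbol\xi}:\boldsymbol\xi \text{ a coset representative of }\mathbb{Z}^s/M^T\mathbb{Z}^s\}$ (exponential taken componentwise), which contains $\mathbf 1$. $D^{\boldsymbol\gamma}$ is the partial derivative of multi-index $\boldsymbol\gamma$. $q_{\mathbf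 0}=1$ and $q_{\boldsymbol\gamma}(z_1,\dots,z_s)=\prod_{\ell=1}^s\prod_{j=0}^{\gamma_\ell-1}(z_\ell-j)$. Powers with real exponents follow the convention $(e^{\boldsymbol x})^{\mathbf y}=e^{\boldsymbol x\cdot\mathbf y}$; thus for $\boldsymbol\epsilon=\mathbf 1$, $\mathbf v^{\mathbf y}=e^{-\boldsymbol\lambda^TM^{-(k+1)}\mathbf y}$.
   Formalization: Added hypothesis: the span of x^γ, γ∈Γ, is invariant under translations and under x↦M^{-1}x. For arbitrary Γ the claim fails: s=1, M=2, Γ={1}, Λ={0}, a^[0]=1+(1+z)²/2, a^[k]=(1+z)²/2 for k≥1, τ=1 meets all conditions but x is not reproduced. *)

theory Defs
  imports "HOL-Analysis.Analysis"
begin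

subsection \<open>Matrices and multi-indices\<close>

definition real_mat :: "int^'n^'n \<Rightarrow> real^'n^'n" where
  "real_mat = map_matrix real_of_int"

definition cmplx_mat :: "real^'n^'n \<Rightarrow> complex^'n^'n" where
  "cmplx_mat = map_matrix complex_of_real"

definition real_vec :: "int^'n \<Rightarrow> real^'n" where
  "real_vec \<alpha> = (\<chi> i. real_of_int (\<alpha> $ i))"

text \<open>The instance of \<open>*\<close> for vectors is componentwise, so powers with respect to the matrix
  product are defined separately.\<close>

primrec mat_pow :: "real^'n^'n \<Rightarrow> nat \<Rightarrow> real^'n^'n" where
  "mat_pow A 0 = mat 1"
| "mat_pow A (Suc k) = A ** mat_pow A k"

definition expanding :: "int^'n^'n \<Rightarrow> bool" where
  "expanding M \<longleftrightarrow>
     (\<forall>(\<mu>::complex) v. v \<noteq> 0 \<and> cmplx_mat (real_mat M) *v v = \<mu> *s v \<longrightarrow> norm \<mu> > 1)"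

definition Minv_pow :: "int^'n^'n \<Rightarrow> nat \<Rightarrow> real^'n^'n" where
  "Minv_pow M k = mat_pow (matrix_inv (real_mat M)) k"

definition monom_nat :: "complex^'n \<Rightarrow> nat^'n \<Rightarrow> complex" where
  "monom_nat z \<gamma> = (\<Prod>j\<in>UNIV. (z $ j) ^ (\<gamma> $ j))"

definition monom_int :: "complex^'n \<Rightarrow> int^'n \<Rightarrow> complex" where
  "monom_int z \<alpha> = (\<Prod>j\<in>UNIV. (z $ j) powi (\<alpha> $ j))"

text \<open>\<open>exp_powr x y\<close> is the power \<open>(e\<^sup>x)\<^sup>y\<close> with real exponent vector \<open>y\<close>, under the
  convention that it equals the exponential of the bilinear (unconjugated) product of \<open>x\<close> and \<open>y\<close>;
  it depends on the exponent vector \<open>x\<close> and not only on its componentwise exponential.\<close>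

definition exp_powr :: "complex^'n \<Rightarrow> real^'n \<Rightarrow> complex" where
  "exp_powr x y = exp (\<Sum>j\<in>UNIV. x $ j * complex_of_real (y $ j))"

definition q_poly :: "nat^'n \<Rightarrow> real^'n \<Rightarrow> real" where
  "q_poly \<gamma> z = (\<Prod>l\<in>UNIV. \<Prod>j<\<gamma> $ l. (z $ l - real j))"

subsection \<open>Partial derivatives\<close>

definition partial :: "'n \<Rightarrow> (complex^'n \<Rightarrow> complex) \<Rightarrow> complex^'n \<Rightarrow> complex" where
  "partial j f = (\<lambda>z. deriv (\<lambda>w. f (\<chi> i. if i = j then w else z $ i)) (z $ j))"

text \<open>The coordinates are differentiated along some fixed enumeration of the index type. The
  choice is immaterial for the symbols below, whose partial derivatives commute.\<close>

definition coord_list :: "'n::finite list" where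
  "coord_list = (SOME js. distinct js \<and> set js = UNIV)"

definition multi_deriv :: "nat^'n \<Rightarrow> (complex^'n \<Rightarrow> complex) \<Rightarrow> complex^'n \<Rightarrow> complex" where
  "multi_deriv \<gamma> f = foldr (\<lambda>j. partial j ^^ (\<gamma> $ j)) coord_list f"

subsection \<open>Subdivision schemes\<close>

definition mask_supported :: "(int^'n \<Rightarrow> real) \<Rightarrow> bool" where
  "mask_supported a \<longleftrightarrow>
     (\<exists>N::int. N > 0 \<and> (\<forall>\<alpha>. a \<alpha> \<noteq> 0 \<longrightarrow> (\<forall>j. 0 \<le> \<alpha> $ j \<and> \<alpha> $ j \<le> N)))"

definition mask_symbol :: "(int^'n \<Rightarrow> real) \<Rightarrow> complex^'n \<Rightarrow> complex" where
  "mask_symbol a z = (\<Sum>\<alpha> | a \<alpha> \<noteq> 0. complex_of_real (a \<alpha>) * monom_int z \<alpha>)"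

text \<open>For a finitely supported mask and a nonsingular \<open>M\<close> the index set of the sum is finite, so
  this is the sum over all of \<open>\<int>\<^sup>s\<close>.\<close>

definition subdiv_op ::
    "int^'n^'n \<Rightarrow> (int^'n \<Rightarrow> real) \<Rightarrow> (int^'n \<Rightarrow> complex) \<Rightarrow> int^'n \<Rightarrow> complex" where
  "subdiv_op M a f \<alpha> =
     (\<Sum>\<beta> | a (\<alpha> - M *v \<beta>) \<noteq> 0. complex_of_real (a (\<alpha> - M *v \<beta>)) * f \<beta>)"

text \<open>\<open>subdiv_iter M a l k f\<close> applies the \<open>k\<close> operators with masks \<open>a l, \<dots>, a (l + k - 1)\<close> to
  data \<open>f\<close> of level \<open>l\<close>; the result is of level \<open>l + k\<close>.\<close>

primrec subdiv_iter :: "int^'n^'n \<Rightarrow> (nat \<Rightarrow> int^'n \<Rightarrow> real) \<Rightarrow> nat \<Rightarrow> nat \<Rightarrow>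
    (int^'n \<Rightarrow> complex) \<Rightarrow> int^'n \<Rightarrow> complex" where
  "subdiv_iter M a l 0 f = f"
| "subdiv_iter M a l (Suc k) f = subdiv_op M (a (l + k)) (subdiv_iter M a l k f)"

definition grid_pt :: "int^'n^'n \<Rightarrow> real^'n \<Rightarrow> nat \<Rightarrow> int^'n \<Rightarrow> real^'n" where
  "grid_pt M \<tau> k \<alpha> = Minv_pow M k *v (real_vec \<alpha> + \<tau>)"

text \<open>Multilinear interpolant of data on \<open>\<int>\<^sup>s\<close>: the sets \<open>E\<close> of coordinates enumerate the vertices
  of the unit cell containing \<open>y\<close>.\<close>

definition multilinear :: "(int^'n \<Rightarrow> complex) \<Rightarrow> real^'n \<Rightarrow> complex" where
  "multilinear f y =
     (\<Sum>E\<in>UNIV. complex_of_real (\<Prod>j\<in>UNIV. if j \<in> E then frac (y $ j) else 1 - frac (y $ j)) *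
        f (\<chi> j. \<lfloor>y $ j\<rfloor> + (if j \<in> E then 1 else 0)))"

definition level_interp ::
    "int^'n^'n \<Rightarrow> real^'n \<Rightarrow> nat \<Rightarrow> (int^'n \<Rightarrow> complex) \<Rightarrow> real^'n \<Rightarrow> complex" where
  "level_interp M \<tau> k f x = multilinear f (mat_pow (real_mat M) k *v x - \<tau>)"

definition converges_cu :: "(nat \<Rightarrow> real^'n \<Rightarrow> complex) \<Rightarrow> (real^'n \<Rightarrow> complex) \<Rightarrow> bool" where
  "converges_cu F g \<longleftrightarrow>
     continuous_on UNIV g \<and> (\<forall>K. compact K \<longrightarrow> uniform_limit K F g sequentially)"

text \<open>Initial data are complex, since exponential polynomials are complex-valued. As the masks are
  real, this is equivalent to using real data.\<close>

definition convergent_scheme ::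
    "int^'n^'n \<Rightarrow> (nat \<Rightarrow> int^'n \<Rightarrow> real) \<Rightarrow> real^'n \<Rightarrow> bool" where
  "convergent_scheme M a \<tau> \<longleftrightarrow>
     (\<forall>f. \<exists>g. converges_cu (\<lambda>k. level_interp M \<tau> k (subdiv_iter M a 0 k f)) g) \<and>
     (\<exists>f g. converges_cu (\<lambda>k. level_interp M \<tau> k (subdiv_iter M a 0 k f)) g \<and> (\<exists>x. g x \<noteq> 0))"

subsection \<open>Exponential polynomials and reproduction\<close>

definition exp_monom :: "nat^'n \<Rightarrow> complex^'n \<Rightarrow> real^'n \<Rightarrow> complex" where
  "exp_monom \<gamma> lam x = monom_nat (\<chi> j. complex_of_real (x $ j)) \<gamma> * exp_powr lam x"

definition EP :: "(nat^'n) set \<Rightarrow> (complex^'n) set \<Rightarrow> (real^'n \<Rightarrow> complex) set" where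
  "EP \<Gamma> \<Lambda> = {(\<lambda>x. \<Sum>(\<gamma>, lam)\<in>T. c (\<gamma>, lam) * exp_monom \<gamma> lam x) | T c.
     finite T \<and> T \<subseteq> \<Gamma> \<times> \<Lambda>}"

text \<open>The polynomials spanned by the powers with exponents in \<open>\<Gamma>\<close> form a space that is invariant
  under translations and under the substitution of \<open>M\<^bsup>-1\<^esup>x\<close> for \<open>x\<close>. Translation invariance says
  that \<open>\<Gamma>\<close> is closed under passing to smaller multi-indices. For all multi-indices up to a given total
  degree both invariances hold with every \<open>M\<close>. Without such a condition on \<open>\<Gamma>\<close> the derivative
  conditions do not imply reproduction: the derivative conditions at \<open>\<gamma>\<close> alone do not
  control the lower-order moments of a mask, nor the moments of the same total degree that a
  non-diagonal \<open>M\<close> mixes in.\<close>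

definition invariant_exponents :: "int^'n^'n \<Rightarrow> (nat^'n) set \<Rightarrow> bool" where
  "invariant_exponents M \<Gamma> \<longleftrightarrow>
     (\<forall>p\<in>EP \<Gamma> {0}. (\<forall>y. (\<lambda>x. p (x + y)) \<in> EP \<Gamma> {0}) \<and>
        (\<lambda>x. p (matrix_inv (real_mat M) *v x)) \<in> EP \<Gamma> {0})"

definition reproduces_EP ::
    "int^'n^'n \<Rightarrow> (nat \<Rightarrow> int^'n \<Rightarrow> real) \<Rightarrow> (nat^'n) set \<Rightarrow> (complex^'n) set \<Rightarrow> bool" where
  "reproduces_EP M a \<Gamma> \<Lambda> \<longleftrightarrow>
     (\<exists>\<tau>. \<forall>p\<in>EP \<Gamma> \<Lambda>. \<forall>l.
        converges_cu
          (\<lambda>k. level_interp M \<tau> (l + k + 1)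
                 (subdiv_iter M a l (k + 1) (\<lambda>\<alpha>. p (grid_pt M \<tau> l \<alpha>)))) p)"

text \<open>The vector belonging to \<open>\<xi>\<close> depends only on the coset of \<open>\<xi>\<close> modulo \<open>M\<^sup>T \<int>\<^sup>s\<close>, so letting
  \<open>\<xi>\<close> range over all integer vectors gives the same set as any system of coset representatives.\<close>

definition Xi :: "int^'n^'n \<Rightarrow> (complex^'n) set" where
  "Xi M = range (\<lambda>\<xi>::int^'n. \<chi> j.
     exp (2 * complex_of_real pi * \<i> *
       complex_of_real ((transpose (matrix_inv (real_mat M)) *v real_vec \<xi>) $ j)))"

text \<open>The row vector \<open>-lam\<^sup>T M\<^bsup>-k\<^esup>\<close>, whose componentwise exponential, multiplied by \<open>\<epsilon>\<close>, is the
  evaluation point.\<close>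

definition log_pt :: "int^'n^'n \<Rightarrow> nat \<Rightarrow> complex^'n \<Rightarrow> complex^'n" where
  "log_pt M k lam = - (lam v* cmplx_mat (Minv_pow M k))"

definition eval_pt :: "int^'n^'n \<Rightarrow> nat \<Rightarrow> complex^'n \<Rightarrow> complex^'n \<Rightarrow> complex^'n" where
  "eval_pt M k lam \<epsilon> = (\<chi> j. \<epsilon> $ j * exp (log_pt M k lam $ j))"

end

theory Submission
  imports Defs "HOL-Computational_Algebra.Fundamental_Theorem_Algebra" "HOL-Combinatorics.Stirling"
begin

text \<open>
  The derivative conditions make a single subdivision step exact: samples of an exponential
  polynomial on the grid of level \<open>k\<close> are mapped to its samples on the grid of level \<open>k + 1\<close>. By
  iteration the data of every later level are exact samples, and the theorem reduces to the
  convergence of the interpolants of samples on finer and finer grids.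

  For the exactness of one step (\<open>subdiv_op_reproduces_exp_monom\<close>), the value at \<open>\<alpha>\<close> is a sum over
  those mask indices \<open>\<eta>\<close> that lie in the coset \<open>\<alpha> + M \<int>\<^sup>s\<close>. Orthogonality of the characters in
  \<open>Xi M\<close> (\<open>sum_Xi_monom_int\<close>) turns it into \<open>1 / \<bar>det M\<bar>\<close> times a sum over all characters \<open>\<epsilon>\<close> of
  unrestricted sums, which are moments \<open>\<Sum>\<eta>. a\<^sub>\<eta> v\<^sup>\<eta> Q(\<eta>)\<close> with \<open>v\<close> the evaluation point of \<open>\<epsilon>\<close> and \<open>Q\<close> a
  polynomial. On the other hand, \<open>v\<^sup>\<gamma> D\<^sup>\<gamma> a(v)\<close> is the moment with \<open>Q = q\<^sub>\<gamma>\<close>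
  (\<open>monom_nat_mult_multi_deriv_symbol\<close>). The invariance of \<open>\<Gamma>\<close> ensures that the polynomials \<open>Q\<close> that
  occur are spanned by the powers with exponents in \<open>\<Gamma>\<close>, and also that \<open>\<Gamma>\<close> is closed downwards
  (\<open>invariant_exponents_downward_closed\<close>), so that they are spanned by the \<open>q\<^sub>\<gamma>\<close> with \<open>\<gamma> \<in> \<Gamma>\<close> as well.
  Thus the moments vanish for \<open>\<epsilon> \<noteq> 1\<close>, and for \<open>\<epsilon> = 1\<close> they are \<open>\<bar>det M\<bar> v\<^bsup>\<sigma>\<^esup> Q(\<sigma>)\<close> with
  \<open>\<sigma> = M\<tau> - \<tau>\<close>, which is the value wanted.

  Two facts about \<open>M\<close> enter. The number of characters is exactly \<open>\<bar>det M\<bar>\<close> (\<open>card_Xi\<close>), which is shown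
  by comparing the volumes of two fundamental domains of a lattice. And \<open>M\<^bsup>-k\<^esup>\<close> tends to 0
  (\<open>Minv_pow_tendsto_0\<close>), which follows from the bound on the eigenvalues by induction on the degree
  of an annihilating polynomial.\<close>

section \<open>Integer dilation matrices\<close>

lemma invertible_if_expanding:
  fixes M :: "int^'n^'n"
  assumes "expanding M"
  shows "invertible (real_mat M)"
proof -
  (* A kernel vector would be an eigenvector for the eigenvalue 0. *)
  have "\<forall>v. cmplx_mat (real_mat M) *v v = 0 \<longrightarrow> v = 0"
    using assms unfolding expanding_def
    by (metis norm_zero not_one_less_zero vector_smult_lzero)
  then have 1: "invertible (cmplx_mat (real_mat M))"
    using matrix_left_invertible_ker invertible_left_inverse by blast
  have "det (cmplx_mat (real_mat M)) = complex_of_real (det (real_mat M))"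
    by (simp add: det_def cmplx_mat_def)
  with 1 show ?thesis
    by (metis invertible_det_nz of_real_0)
qed

lemma det_real_mat: "det (real_mat M) = real_of_int (det M)"
  by (simp add: det_def real_mat_def)

lemma matrix_inv_cancel:
  fixes A :: "real^'n^'n"
  assumes "invertible A"
  shows "A *v (matrix_inv A *v x) = x" "matrix_inv A *v (A *v x) = x"
proof -
  have "A ** matrix_inv A = mat 1 \<and> matrix_inv A ** A = mat 1"
    using someI_ex[OF assms[unfolded invertible_def]] unfolding matrix_inv_def by simp
  then show "A *v (matrix_inv A *v x) = x" "matrix_inv A *v (A *v x) = x"
    by (simp_all add: matrix_vector_mul_assoc)
qed

lemma mat_pow_vec: "mat_pow A k *v x = ((*v) A ^^ k) x"
  by (induction k) (simp_all flip: matrix_vector_mul_assoc)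

lemma Minv_pow_vec_cancel:
  fixes M :: "int^'n^'n"
  assumes "invertible (real_mat M)"
  shows "Minv_pow M (Suc k) *v (real_mat M *v x) = Minv_pow M k *v x"
    and "Minv_pow M k *v (mat_pow (real_mat M) k *v x) = x"
proof -
  show 1: "Minv_pow M (Suc k) *v (real_mat M *v x) = Minv_pow M k *v x" for k x
    unfolding Minv_pow_def mat_pow_vec funpow_Suc_right
    by (simp add: matrix_inv_cancel[OF assms])
  show "Minv_pow M k *v (mat_pow (real_mat M) k *v x) = x"
  proof (induction k arbitrary: x)
    case (Suc k)
    have "mat_pow (real_mat M) (Suc k) *v x = real_mat M *v (mat_pow (real_mat M) k *v x)"
      by (simp add: matrix_vector_mul_assoc)
    then show ?case using 1 Suc by simp
  qed (simp add: Minv_pow_def)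
qed

lemma real_mat_vec: "real_vec (M *v \<beta>) = real_mat M *v real_vec \<beta>"
  by (simp add: vec_eq_iff real_vec_def real_mat_def matrix_vector_mult_def)

lemma real_vec_arith:
  "real_vec (\<alpha> + \<beta>) = real_vec \<alpha> + real_vec \<beta>" "real_vec (\<alpha> - \<beta>) = real_vec \<alpha> - real_vec \<beta>"
  "real_vec (- \<alpha>) = - real_vec \<alpha>" "real_vec 0 = 0" "real_vec \<alpha> $ j = real_of_int (\<alpha> $ j)"
  by (simp_all add: vec_eq_iff real_vec_def)

lemma real_vec_inject: "real_vec \<alpha> = real_vec \<beta> \<longleftrightarrow> \<alpha> = \<beta>"
  by (simp add: vec_eq_iff real_vec_def)

section \<open>Powers of a matrix with small eigenvalues\<close>

lemma contracting_recurrence_tendsto_0: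
  fixes x :: "nat \<Rightarrow> complex^'n"
  assumes rec: "\<And>k. x (Suc k) = \<mu> *s x k + w k" and mu: "norm \<mu> < 1" and w: "w \<longlonglongrightarrow> 0"
  shows "x \<longlonglongrightarrow> 0"
proof -
  have nsm: "norm (c *s y) = norm c * norm y" for c :: complex and y :: "complex^'n"
    by (simp add: norm_vec_def L2_set_def norm_mult power_mult_distrib
        real_sqrt_mult flip: sum_distrib_left)
  show ?thesis
  proof (rule LIMSEQ_I)
    fix e :: real assume e: "e > 0"
    (* The number e / 2 is the fixed point of the map t -> norm \<mu> * t + d. *)
    define d where "d = (e / 2) * (1 - norm \<mu>)"
    have "d > 0" using e mu by (simp add: d_def)
    then obtain K where K: "\<And>k. k \<ge> K \<Longrightarrow> norm (w k) < d"
      using LIMSEQ_D[OF w] by auto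
    have bound: "norm (x (K + j)) \<le> norm \<mu> ^ j * norm (x K) + e / 2" for j
    proof (induction j)
      case (Suc j)
      have "norm (x (K + Suc j)) \<le> norm \<mu> * norm (x (K + j)) + norm (w (K + j))"
        using norm_triangle_ineq[of "\<mu> *s x (K + j)" "w (K + j)"] by (simp add: rec nsm)
      also have "\<dots> \<le> norm \<mu> * (norm \<mu> ^ j * norm (x K) + e / 2) + d"
        using Suc K[of "K + j"] by (intro add_mono mult_left_mono) auto
      also have "\<dots> = norm \<mu> ^ Suc j * norm (x K) + e / 2"
        by (simp add: d_def field_simps)
      finally show ?case .
    qed (use e in simp)
    have "(\<lambda>j. norm \<mu> ^ j * norm (x K)) \<longlonglongrightarrow> 0"
      using LIMSEQ_power_zero[of "norm \<mu>"] mu by (auto intro!: tendsto_eq_intros)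
    then obtain J where J: "\<And>j. j \<ge> J \<Longrightarrow> norm (norm \<mu> ^ j * norm (x K) - 0) < e / 2"
      using LIMSEQ_D[of _ 0 "e/2"] e by (meson half_gt_zero)
    have "norm (x k - 0) < e" if "k \<ge> K + J" for k
    proof -
      have "norm (x k) \<le> norm \<mu> ^ (k - K) * norm (x K) + e / 2"
        using bound[of "k - K"] that by simp
      also have "\<dots> < e" using J[of "k - K"] that by (simp add: le_diff_conv2 add.commute)
      finally show ?thesis by simp
    qed
    then show "\<exists>no. \<forall>n\<ge>no. norm (x n - 0) < e" by blast
  qed
qed

lemma tendsto_matrix_vector_mult:
  fixes A :: "'a::real_normed_field^'n^'m"
  assumes "(x \<longlongrightarrow> y) F"
  shows "((\<lambda>k. A *v x k) \<longlongrightarrow> A *v y) F"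
  unfolding matrix_vector_mult_def
  by (intro tendsto_vec_lambda tendsto_sum tendsto_mult tendsto_const tendsto_vec_nth assms)

definition apply_poly :: "complex^'n^'n \<Rightarrow> complex poly \<Rightarrow> complex^'n \<Rightarrow> complex^'n" where
  "apply_poly A p v = (\<Sum>i\<le>degree p. coeff p i *s ((*v) A ^^ i) v)"

lemma apply_poly_upto:
  assumes "degree p \<le> N"
  shows "apply_poly A p v = (\<Sum>i\<le>N. coeff p i *s ((*v) A ^^ i) v)"
  unfolding apply_poly_def using assms
  by (intro sum.mono_neutral_left) (auto simp: coeff_eq_0 not_le)

lemma funpow_matrix_linear:
  fixes A :: "complex^'n^'n"
  shows "((*v) A ^^ i) (x + y) = ((*v) A ^^ i) x + ((*v) A ^^ i) y"
    "((*v) A ^^ i) (c *s x) = c *s ((*v) A ^^ i) x"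
    "((*v) A ^^ i) (x - y) = ((*v) A ^^ i) x - ((*v) A ^^ i) y"
  by (induction i) (simp_all add: matrix_vector_right_distrib matrix_vector_mult_diff_distrib vec.scale)

text \<open>Splitting off a root trades one degree of the polynomial for replacing \<open>v\<close> by \<open>(A - \<mu>)v\<close>; the
  induction that bounds the powers of \<open>A\<close> runs along this identity.\<close>

lemma apply_poly_linear_factor:
  "apply_poly A ([:-\<mu>, 1:] * q) v = apply_poly A q (A *v v - \<mu> *s v)"
proof -
  define N where "N = degree q"
  have d: "degree ([:-\<mu>, 1:] * q) \<le> Suc N"
    using degree_mult_le[of "[:-\<mu>, 1:]" q] by (simp add: N_def)
  have c: "[:-\<mu>, 1:] * q = pCons 0 q - smult \<mu> q" by simp
  have "apply_poly A ([:-\<mu>, 1:] * q) v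
      = (\<Sum>i\<le>Suc N. coeff (pCons 0 q) i *s ((*v) A ^^ i) v) -
        (\<Sum>i\<le>Suc N. (\<mu> * coeff q i) *s ((*v) A ^^ i) v)"
    unfolding apply_poly_upto[OF d]
    unfolding c by (simp only: coeff_diff coeff_smult vec.scale_left_diff_distrib sum_subtractf)
  also have "(\<Sum>i\<le>Suc N. coeff (pCons 0 q) i *s ((*v) A ^^ i) v) = apply_poly A q (A *v v)"
    unfolding sum.atMost_Suc_shift apply_poly_def N_def funpow_Suc_right by simp
  also have "(\<Sum>i\<le>Suc N. (\<mu> * coeff q i) *s ((*v) A ^^ i) v) = apply_poly A q (\<mu> *s v)"
    unfolding apply_poly_def
    by (simp add: N_def coeff_eq_0 funpow_matrix_linear vector_smult_assoc mult.commute)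
  finally show ?thesis
    by (simp add: apply_poly_def funpow_matrix_linear vec.scale_right_diff_distrib sum_subtractf)
qed

text \<open>More vectors \<open>A\<^sup>i v\<close> than the real dimension of the space are linearly dependent, unless two of
  them coincide; either way a nontrivial relation arises, and its coefficients form the polynomial.\<close>

lemma annihilating_poly_exists:
  fixes A :: "complex^'n^'n"
  shows "\<exists>p. p \<noteq> 0 \<and> apply_poly A p v = 0"
proof -
  define x where "x i = ((*v) A ^^ i) v" for i
  define N where "N = DIM(complex^'n)"
  show ?thesis
  proof (cases "inj_on x {..N}")
    case False
    then obtain i j where ij: "i \<noteq> j" "x i = x j" by (auto simp: inj_on_def)
    define p where "p = monom (1::complex) i - monom 1 j"
    have "coeff p i = 1" using ij by (simp add: p_def)
    then have p0: "p \<noteq> 0" by auto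
    have "degree p \<le> max i j"
      unfolding p_def by (intro degree_diff_le order.trans[OF degree_monom_le]) auto
    then have "apply_poly A p v = (\<Sum>k\<le>max i j. (if i = k then x k else 0) - (if j = k then x k else 0))"
      unfolding apply_poly_upto[OF \<open>degree p \<le> max i j\<close>] 
      by (intro sum.cong) (auto simp: p_def x_def)
    also have "\<dots> = 0" using ij by (simp add: sum_subtractf)
    finally show ?thesis using p0 by blast
  next
    case True
    then have "card (x ` {..N}) = Suc N" by (simp add: card_image)
    then have "dependent (x ` {..N})"
      by (intro dependent_biggerset) (auto simp: N_def)
    then obtain u where u: "\<exists>y\<in>x ` {..N}. u y \<noteq> 0" "(\<Sum>y\<in>x ` {..N}. u y *\<^sub>R y) = 0"
      by (auto simp: dependent_finite)
    define p where "p = Poly (map (\<lambda>i. complex_of_real (u (x i))) [0..<Suc N])"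
    have cp: "coeff p i = (if i \<le> N then complex_of_real (u (x i)) else 0)" for i
      unfolding p_def coeff_Poly_eq by (auto simp: nth_default_def simp del: upt_Suc)
    have "p \<noteq> 0" using u(1) cp by (metis atMost_iff coeff_0 imageE of_real_eq_0_iff)
    moreover have "degree p \<le> N" by (rule degree_le) (simp add: cp)
    then have "apply_poly A p v = (\<Sum>i\<le>N. u (x i) *\<^sub>R x i)"
      unfolding apply_poly_upto[OF \<open>degree p \<le> N\<close>]
      by (intro sum.cong) (auto simp: cp x_def vec_eq_iff scaleR_conv_of_real[where 'a=complex])
    then have "apply_poly A p v = 0" using u(2) True by (simp add: sum.reindex)
    ultimately show ?thesis by blast
  qed
qed

text \<open>Induction on the degree, in place of a Jordan normal form. For a root \<open>\<mu>\<close> of \<open>p\<close>, the vector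
  \<open>w = (A - \<mu>)v\<close> is annihilated by the quotient polynomial, so \<open>A\<^sup>k w\<close> tends to 0. If \<open>\<mu>\<close> is small,
  then \<open>A\<^sup>k v\<close> satisfies a contracting recurrence perturbed by \<open>A\<^sup>k w\<close>. Otherwise \<open>\<mu>\<close> is not an
  eigenvalue, \<open>A - \<mu>\<close> has a left inverse \<open>B\<close>, and \<open>A\<^sup>k v = B A\<^sup>k w\<close>.\<close>

lemma powers_tendsto_0_if_annihilated:
  fixes A :: "complex^'n^'n"
  assumes ev: "\<And>\<mu> v. v \<noteq> 0 \<Longrightarrow> A *v v = \<mu> *s v \<Longrightarrow> norm \<mu> < 1"
  assumes "p \<noteq> 0" "apply_poly A p v = 0"
  shows "(\<lambda>k. ((*v) A ^^ k) v) \<longlonglongrightarrow> 0"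
  using assms(2,3)
proof (induction "degree p" arbitrary: p v)
  case 0
  then obtain c where "p = [:c:]" "c \<noteq> 0" by (metis degree_0_id pCons_0_0)
  then have "v = 0" using 0 by (simp add: apply_poly_def)
  moreover have "((*v) A ^^ k) 0 = 0" for k by (induction k) auto
  ultimately show ?case by simp
next
  case (Suc d)
  obtain \<mu> where "poly p \<mu> = 0"
    using Suc.hyps(2) by (metis alg_closed_imp_poly_has_root zero_less_Suc)
  then obtain q where q: "p = [:-\<mu>, 1:] * q" by (auto simp: poly_eq_0_iff_dvd)
  define w where "w = A *v v - \<mu> *s v"
  have "q \<noteq> 0" using Suc.prems(1) q by auto
  moreover from this have "degree q = d"
    using Suc.hyps(2) unfolding q by (subst (asm) degree_mult_eq) auto
  ultimately have w0: "(\<lambda>k. ((*v) A ^^ k) w) \<longlonglongrightarrow> 0"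
    using Suc.hyps(1)[of q w] Suc.prems(2) unfolding q apply_poly_linear_factor w_def by blast
  have step: "((*v) A ^^ k) w = A *v ((*v) A ^^ k) v - \<mu> *s ((*v) A ^^ k) v" for k
    by (simp add: w_def funpow_matrix_linear flip: funpow_swap1)
  show ?case
  proof (cases "norm \<mu> < 1")
    case True
    show ?thesis
      by (rule contracting_recurrence_tendsto_0[OF _ True w0]) (simp add: step)
  next
    case False
    have "\<forall>x. (A - mat \<mu>) *v x = 0 \<longrightarrow> x = 0"
    proof (intro allI impI)
      fix x assume "(A - mat \<mu>) *v x = 0"
      moreover have "mat \<mu> *v x = \<mu> *s x"
        by (simp add: vec_eq_iff mat_def matrix_vector_mult_def if_distrib[of "\<lambda>a. a * _"] cong: if_cong)
      ultimately have "A *v x = \<mu> *s x" by (simp add: matrix_vector_mult_diff_rdistrib)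
      with ev False show "x = 0" by blast
    qed
    then obtain B where B: "B ** (A - mat \<mu>) = mat 1"
      using matrix_left_invertible_ker by blast
    have "((*v) A ^^ k) v = B *v ((*v) A ^^ k) w" for k
    proof -
      let ?x = "((*v) A ^^ k) v"
      have "mat \<mu> *v ?x = \<mu> *s ?x"
        by (simp add: vec_eq_iff mat_def matrix_vector_mult_def if_distrib[of "\<lambda>a. a * _"] cong: if_cong)
      then have "((*v) A ^^ k) w = (A - mat \<mu>) *v ?x"
        by (simp add: step matrix_vector_mult_diff_rdistrib)
      then show ?thesis by (simp add: matrix_vector_mul_assoc B)
    qed
    then show ?thesis using tendsto_matrix_vector_mult[OF w0, of B] by simp
  qed
qed

text \<open>The eigenvalues of \<open>M\<^bsup>-1\<^esup>\<close> are the reciprocals of those of \<open>M\<close>, hence small. As they may be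
  complex, the powers are studied on the complexification. This is what makes the grids
  \<open>M\<^bsup>-k\<^esup>(\<int>\<^sup>s + \<tau>)\<close> arbitrarily fine.\<close>

lemma Minv_pow_tendsto_0:
  fixes M :: "int^'n^'n"
  assumes "expanding M"
  shows "(\<lambda>k. Minv_pow M k *v x) \<longlonglongrightarrow> 0"
proof -
  define emb :: "real^'n \<Rightarrow> complex^'n" where "emb y = (\<chi> i. complex_of_real (y $ i))" for y
  define C where "C = cmplx_mat (real_mat M)"
  define A where "A = cmplx_mat (matrix_inv (real_mat M))"
  note inv = invertible_if_expanding[OF assms]
  have "real_mat M ** matrix_inv (real_mat M) = mat 1"
    using matrix_inv_cancel(1)[OF inv] by (simp add: matrix_eq flip: matrix_vector_mul_assoc)
  moreover have hom: "cmplx_mat (X ** Y) = cmplx_mat X ** cmplx_mat Y" for X Y :: "real^'n^'n"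
    by (simp add: cmplx_mat_def vec_eq_iff matrix_matrix_mult_def)
  moreover have "cmplx_mat (mat 1 :: real^'n^'n) = mat 1"
    by (simp add: cmplx_mat_def vec_eq_iff mat_def)
  ultimately have CA: "C ** A = mat 1" unfolding C_def A_def by metis
  have ev: "norm \<mu> < 1" if v: "v \<noteq> 0" "A *v v = \<mu> *s v" for \<mu> v
  proof -
    have *: "v = \<mu> *s (C *v v)"
      using CA v(2) by (metis matrix_vector_mul_assoc matrix_vector_mul_lid vec.scale)
    with v have nz: "\<mu> \<noteq> 0" by auto
    then have "C *v v = inverse \<mu> *s v"
      using arg_cong[OF *, of "\<lambda>x. inverse \<mu> *s x"] by simp
    then have "norm (inverse \<mu>) > 1" using assms v(1) unfolding expanding_def C_def by blast
    then show ?thesis using nz by (simp add: norm_inverse one_less_inverse_iff)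
  qed
  obtain p where "p \<noteq> 0" "apply_poly A p (emb x) = 0"
    using annihilating_poly_exists by blast
  with ev have lim: "(\<lambda>k. ((*v) A ^^ k) (emb x)) \<longlonglongrightarrow> 0"
    by (intro powers_tendsto_0_if_annihilated) auto
  have emb: "A *v emb y = emb (matrix_inv (real_mat M) *v y)" for y
    by (simp add: A_def emb_def vec_eq_iff matrix_vector_mult_def cmplx_mat_def)
  have "((*v) A ^^ k) (emb x) = emb (Minv_pow M k *v x)" for k
    unfolding Minv_pow_def mat_pow_vec by (induction k) (simp_all add: emb)
  with lim have lim': "(\<lambda>k. emb (Minv_pow M k *v x)) \<longlonglongrightarrow> 0" by simp
  show ?thesis
  proof (rule vec_tendstoI)
    fix i
    have "(\<lambda>k. Re (emb (Minv_pow M k *v x) $ i)) \<longlonglongrightarrow> Re ((0::complex^'n) $ i)"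
      by (intro tendsto_Re tendsto_vec_nth lim')
    then show "(\<lambda>k. (Minv_pow M k *v x) $ i) \<longlonglongrightarrow> 0 $ i" by (simp add: emb_def)
  qed
qed

section \<open>Lattice points in a parallelepiped\<close>

text \<open>Cut \<open>A\<close> along the translates of \<open>B\<close> and translate each piece back into \<open>B\<close>: since the translates
  of \<open>A\<close> tile the space as well, the moved pieces fill \<open>B\<close> without overlap.\<close>

lemma emeasure_fundamental_domains_eq:
  fixes A B :: "(real^'n) set" and t :: "'i \<Rightarrow> real^'n"
  assumes A [measurable]: "A \<in> sets lebesgue" and B [measurable]: "B \<in> sets lebesgue"
    and I: "countable (UNIV :: 'i set)"
    and tileA: "\<And>x. \<exists>!i. x + t i \<in> A" and tileB: "\<And>x. \<exists>!i. x - t i \<in> B"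
  shows "emeasure lebesgue A = emeasure lebesgue B"
proof -
  have meas: "(\<lambda>x. x + c) ` S \<in> sets lebesgue" if "S \<in> sets lebesgue" for c :: "real^'n" and S
    using lebesgue_sets_translation[OF that, of c] by (simp add: add.commute)
  define P where "P i = (\<lambda>x. x + t i) ` B" for i
  define Q where "Q i = (\<lambda>x. x - t i) ` A" for i
  have P: "x \<in> P i \<longleftrightarrow> x - t i \<in> B" for x i unfolding P_def by (force simp: image_iff)
  have Q: "x \<in> Q i \<longleftrightarrow> x + t i \<in> A" for x i unfolding Q_def by (force simp: image_iff)
  have Pm: "P i \<in> sets lebesgue" for i unfolding P_def by (rule meas[OF B])
  have Qm: "Q i \<in> sets lebesgue" for i unfolding Q_def using meas[OF A, of "- t i"] by simp
  have "A = (\<Union>i. A \<inter> P i)" using tileB by (auto simp: P) metis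
  then have "emeasure lebesgue A = emeasure lebesgue (\<Union>i. A \<inter> P i)" by simp
  also have "\<dots> = (\<integral>\<^sup>+i. emeasure lebesgue (A \<inter> P i) \<partial>count_space UNIV)"
  proof (rule emeasure_UN_countable[OF _ I])
    show "disjoint_family (\<lambda>i. A \<inter> P i)"
      unfolding disjoint_family_on_def using tileB P by blast
  qed (use Pm in auto)
  also have "\<dots> = (\<integral>\<^sup>+i. emeasure lebesgue (Q i \<inter> B) \<partial>count_space UNIV)"
  proof (intro nn_integral_cong)
    fix i
    have "A \<inter> P i = (\<lambda>x. t i + x) ` (Q i \<inter> B)"
      by (force simp: P Q image_iff add.commute)
    then show "emeasure lebesgue (A \<inter> P i) = emeasure lebesgue (Q i \<inter> B)"
      using emeasure_lebesgue_affine[of 1 "t i" "Q i \<inter> B"] by (simp add: add.commute)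
  qed
  also have "\<dots> = emeasure lebesgue (\<Union>i. Q i \<inter> B)"
  proof (rule emeasure_UN_countable[OF _ I, symmetric])
    show "disjoint_family (\<lambda>i. Q i \<inter> B)"
      unfolding disjoint_family_on_def using tileA Q by blast
  qed (use Qm B in auto)
  also have "(\<Union>i. Q i \<inter> B) = B" using tileA by (auto simp: Q) metis
  finally show ?thesis .
qed

definition unit_cube :: "(real^'n) set" where
  "unit_cube = {x. \<forall>j. 0 \<le> x $ j \<and> x $ j < 1}"

definition floor_vec :: "real^'n \<Rightarrow> int^'n" where
  "floor_vec x = (\<chi> j. \<lfloor>x $ j\<rfloor>)"

lemma diff_in_unit_cube_iff: "x - real_vec \<beta> \<in> unit_cube \<longleftrightarrow> \<beta> = floor_vec x"
proof -
  have "0 \<le> x $ j - real_of_int (\<beta> $ j) \<and> x $ j - real_of_int (\<beta> $ j) < 1 \<longleftrightarrow> \<beta> $ j = \<lfloor>x $ j\<rfloor>" for j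
    by linarith
  then show ?thesis by (simp add: unit_cube_def floor_vec_def vec_eq_iff real_vec_def)
qed

lemma unit_cube_measurable: "unit_cube \<in> sets lborel"
  unfolding unit_cube_def by measurable

lemma emeasure_unit_cube: "emeasure lebesgue (unit_cube :: (real^'n) set) = 1"
proof -
  have m: "(unit_cube :: (real^'n) set) \<in> sets lborel" by (rule unit_cube_measurable)
  have "box 0 1 \<subseteq> (unit_cube :: (real^'n) set)" "(unit_cube :: (real^'n) set) \<subseteq> cbox 0 1"
    by (auto simp: unit_cube_def mem_box_cart less_imp_le)
  moreover have "(1::real^'n) \<bullet> b = 1" if "b \<in> Basis" for b
    using that by (auto simp: Basis_vec_def inner_axis)
  then have "emeasure lborel (box 0 (1::real^'n)) = 1" "emeasure lborel (cbox 0 (1::real^'n)) = 1"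
    by (simp_all add: emeasure_lborel_box_eq emeasure_lborel_cbox_eq)
  ultimately have "emeasure lborel (unit_cube :: (real^'n) set) = 1"
    using emeasure_mono[of "box 0 (1::real^'n)" unit_cube lborel]
      emeasure_mono[of "unit_cube" "cbox 0 (1::real^'n)" lborel] m by auto
  then show ?thesis using m by (simp add: main_part_sets)
qed

text \<open>Two fundamental domains of the lattice \<open>N \<int>\<^sup>n\<close> are compared: the parallelepiped \<open>N [0,1)\<^sup>n\<close>, of
  volume \<open>\<bar>det N\<bar>\<close>, and the union of the unit cubes whose corners are the integer points in that
  parallelepiped, whose volume is the number of these points. The volume formula for linear images
  asks for a well-ordered index type; renaming the indices removes this condition afterwards.\<close>

lemma card_lattice_points_of_parallelepiped_wellorder:
  fixes N :: "int^'n::{finite,wellorder}^'n::_"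
  assumes inv: "invertible (real_mat N)"
  defines "R \<equiv> {\<xi>. matrix_inv (real_mat N) *v real_vec \<xi> \<in> unit_cube}"
  shows "finite R" "card R = nat \<bar>det N\<bar>"
proof -
  let ?A = "real_mat N" and ?B = "matrix_inv (real_mat N)"
  note c = matrix_inv_cancel[OF inv]
  define F where "F = (*v) ?A ` unit_cube"
  define G where "G = {x::real^'n::_. floor_vec x \<in> R}"
  have lm: "(unit_cube :: (real^'n::_) set) \<in> lmeasurable"
    using emeasure_unit_cube[where 'n='n] unit_cube_measurable by (auto intro!: fmeasurableI simp del: emeasure_completion)
  have lin: "linear ((*v) ?A)" by simp
  have Fm: "F \<in> lmeasurable" unfolding F_def using measurable_linear_image[of "(*v) ?A" unit_cube] lin lm by simp
  have "measure lebesgue F = \<bar>det ?A\<bar> * measure lebesgue (unit_cube :: (real^'n::_) set)"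
    unfolding F_def using measure_linear_image[of "(*v) ?A" unit_cube] lin lm by simp
  then have mF: "emeasure lebesgue F = ennreal (real_of_int \<bar>det N\<bar>)"
    using emeasure_unit_cube[where 'n='n] Fm
    by (simp add: emeasure_eq_measure2 measure_def[of _ unit_cube] det_real_mat)
  have F: "x \<in> F \<longleftrightarrow> ?B *v x \<in> unit_cube" for x
    unfolding F_def using c by (metis image_iff)
  have G_UN: "G = (\<Union>\<xi>\<in>R. (\<lambda>x. real_vec \<xi> + x) ` unit_cube)"
  proof -
    have "x \<in> (\<lambda>x. real_vec \<xi> + x) ` unit_cube \<longleftrightarrow> \<xi> = floor_vec x" for x :: "real^'n::_" and \<xi>
      unfolding diff_in_unit_cube_iff[symmetric] by (force simp: image_iff)
    then show ?thesis unfolding G_def set_eq_iff UN_iff mem_Collect_eq by simp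
  qed
  have um: "(\<lambda>x. real_vec \<xi> + x) ` unit_cube \<in> sets lebesgue" for \<xi> :: "int^'n::_"
    using unit_cube_measurable by (intro lebesgue_sets_translation) auto
  have Gm: "G \<in> sets lebesgue"
    unfolding G_UN using um by (intro sets.countable_UN') auto
  have "emeasure lebesgue G = (\<integral>\<^sup>+\<xi>. emeasure lebesgue ((\<lambda>x. real_vec \<xi> + x) ` (unit_cube::(real^'n::_) set)) \<partial>count_space R)"
    unfolding G_UN
  proof (rule emeasure_UN_countable)
    show "disjoint_family_on (\<lambda>\<xi>. (\<lambda>x. real_vec \<xi> + x) ` unit_cube) R"
    proof -
      have "x \<in> (\<lambda>x. real_vec \<xi> + x) ` unit_cube \<Longrightarrow> \<xi> = floor_vec x" for x :: "real^'n::_" and \<xi>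
        unfolding diff_in_unit_cube_iff[symmetric] by (force simp: image_iff)
      then show ?thesis unfolding disjoint_family_on_def by blast
    qed
  qed (use um in auto)
  also have "\<dots> = (\<integral>\<^sup>+\<xi>. 1 \<partial>count_space R)"
  proof (intro nn_integral_cong)
    fix \<xi> :: "int^'n::_"
    show "emeasure lebesgue ((\<lambda>x. real_vec \<xi> + x) ` (unit_cube::(real^'n::_) set)) = 1"
      using emeasure_lebesgue_affine[of 1 "real_vec \<xi>" unit_cube] emeasure_unit_cube[where 'n='n]
      by (simp add: add.commute)
  qed
  also have "\<dots> = emeasure (count_space R) R" by simp
  finally have mG: "emeasure lebesgue G = emeasure (count_space R) R" .
  have "emeasure lebesgue F = emeasure lebesgue G"
  proof (rule emeasure_fundamental_domains_eq[where t = "\<lambda>\<beta>. - real_vec (N *v \<beta>)"])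
    fix x :: "real^'n::_"
    have "x + - real_vec (N *v \<beta>) \<in> F \<longleftrightarrow> \<beta> = floor_vec (?B *v x)" for \<beta>
      unfolding F diff_in_unit_cube_iff[symmetric]
      by (simp add: real_mat_vec matrix_vector_mult_diff_distrib c)
    then show "\<exists>!\<beta>. x + - real_vec (N *v \<beta>) \<in> F" by simp
    have fl: "floor_vec (x + real_vec \<beta>) = floor_vec x + \<beta>" for \<beta>
      by (simp add: floor_vec_def vec_eq_iff real_vec_def)
    have "x - - real_vec (N *v \<beta>) \<in> G \<longleftrightarrow> - \<beta> = floor_vec (?B *v real_vec (floor_vec x))" for \<beta>
      unfolding G_def R_def diff_in_unit_cube_iff[symmetric]
      by (simp add: fl[of "N *v \<beta>", unfolded real_mat_vec] real_vec_arith real_mat_vec matrix_vector_right_distrib c)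
    then show "\<exists>!\<beta>. x - - real_vec (N *v \<beta>) \<in> G" by (metis minus_minus)
  qed (use Fm Gm in \<open>auto simp: fmeasurableD\<close>)
  with mF mG have eq: "emeasure (count_space R) R = ennreal (real_of_int \<bar>det N\<bar>)" by simp
  show "finite R"
  proof (rule ccontr)
    assume "infinite R"
    then show False using eq by (simp add: emeasure_count_space)
  qed
  then have "real (card R) = real_of_int \<bar>det N\<bar>"
    using eq by (simp add: emeasure_count_space ennreal_of_nat_eq_real_of_nat)
  then show "card R = nat \<bar>det N\<bar>" by linarith
qed

text \<open>A copy of a finite type, ordered by an enumeration of its elements, to which statements about
  well-ordered index types apply.\<close>

typedef 'a ranked = "UNIV :: 'a set" morphisms unrank mk_ranked
  by simp

instantiation ranked :: (finite) "{finite, wellorder}"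
begin

definition less_eq_ranked :: "'a ranked \<Rightarrow> 'a ranked \<Rightarrow> bool" where
  "less_eq_ranked x y \<longleftrightarrow> to_nat (unrank x) \<le> to_nat (unrank y)"

definition less_ranked :: "'a ranked \<Rightarrow> 'a ranked \<Rightarrow> bool" where
  "less_ranked x y \<longleftrightarrow> to_nat (unrank x) < to_nat (unrank y)"

instance
proof
  show "finite (UNIV :: 'a ranked set)"
    by (rule finite_imageD[of unrank]) (auto simp: inj_on_def unrank_inject intro: finite_subset[OF subset_UNIV])
  fix P :: "'a ranked \<Rightarrow> bool" and x
  assume step: "\<And>x. (\<And>y. y < x \<Longrightarrow> P y) \<Longrightarrow> P x"
  show "P x"
    by (induction x rule: measure_induct_rule[of "\<lambda>x. to_nat (unrank x)"])
      (auto intro: step simp: less_ranked_def)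
qed (auto simp: less_eq_ranked_def less_ranked_def unrank_inject)

end

lemma bij_unrank: "bij unrank"
  by (metis bij_betw_def inj_def mk_ranked_inverse surjI unrank_inject UNIV_I)

text \<open>Permutations are transported along \<open>f\<close>, which preserves their signs.\<close>

lemma det_reindex:
  fixes A :: "'a::comm_ring_1^'n^'n" and f :: "'m::finite \<Rightarrow> 'n"
  assumes f: "bij f"
  shows "det (\<chi> i j. A $ f i $ f j) = det A"
proof -
  have inj: "inj f" and surj: "surj f" using f by (auto simp: bij_def)
  have "bij_betw (map_permutation UNIV f) {p. p permutes UNIV} {p. p permutes UNIV}"
  proof (rule bij_betw_byWitness[where f' = "map_permutation UNIV (inv f)"])
    show "\<forall>p\<in>{p. p permutes UNIV}. map_permutation UNIV (inv f) (map_permutation UNIV f p) = p"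
      using map_permutation_compose_inv[of f UNIV UNIV _ "inv f"] f inj by auto
    show "\<forall>p\<in>{p. p permutes UNIV}. map_permutation UNIV f (map_permutation UNIV (inv f) p) = p"
      using map_permutation_compose_inv[of "inv f" UNIV UNIV _ f] bij_imp_bij_inv[OF f] surj
      by (auto simp: surj_f_inv_f)
  qed (auto intro!: map_permutation_permutes f bij_imp_bij_inv)
  note reindex = sum.reindex_bij_betw[OF this, symmetric]
  have "det A = (\<Sum>p | p permutes (UNIV::'m set).
      of_int (sign (map_permutation UNIV f p)) * (\<Prod>i\<in>UNIV. A $ i $ map_permutation UNIV f p i))"
    unfolding det_def by (rule reindex)
  also have "\<dots> = (\<Sum>p | p permutes (UNIV::'m set). of_int (sign p) * (\<Prod>i\<in>UNIV. A $ f i $ f (p i)))"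
  proof (intro sum.cong refl arg_cong2[where f = "(*)"])
    fix p :: "'m \<Rightarrow> 'm" assume "p \<in> {p. p permutes UNIV}"
    then show "of_int (sign (map_permutation UNIV f p)) = (of_int (sign p) :: 'a)"
      using inj by (simp add: sign_map_permutation)
    show "(\<Prod>i\<in>UNIV. A $ i $ map_permutation UNIV f p i) = (\<Prod>i\<in>UNIV. A $ f i $ f (p i))"
      using prod.reindex_bij_betw[OF f, of "\<lambda>i. A $ i $ map_permutation UNIV f p i"] inj
      by (simp add: map_permutation_apply)
  qed
  finally show ?thesis by (simp add: det_def)
qed

text \<open>Renaming the coordinates by elements of \<open>'n ranked\<close> changes neither the determinant nor the set of
  lattice points, up to a bijection.\<close>

lemma card_lattice_points_of_parallelepiped:
  fixes N :: "int^'n^'n"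
  assumes inv: "invertible (real_mat N)"
  defines "R \<equiv> {\<xi>::int^'n. matrix_inv (real_mat N) *v real_vec \<xi> \<in> unit_cube}"
  shows "finite R" "card R = nat \<bar>det N\<bar>"
proof -
  define N' :: "int^'n ranked^'n ranked" where "N' = (\<chi> i j. N $ unrank i $ unrank j)"
  define g :: "int^'n \<Rightarrow> int^'n ranked" where "g v = (\<chi> i. v $ unrank i)" for v
  define h :: "real^'n \<Rightarrow> real^'n ranked" where "h v = (\<chi> i. v $ unrank i)" for v
  define R' where "R' = {\<xi>. matrix_inv (real_mat N') *v real_vec \<xi> \<in> unit_cube}"
  have det: "det N' = det N" unfolding N'_def by (rule det_reindex[OF bij_unrank])
  then have inv': "invertible (real_mat N')"
    using inv by (simp add: invertible_det_nz det_real_mat)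
  have all: "(\<forall>i. P (unrank i)) \<longleftrightarrow> (\<forall>j. P j)" for P :: "'n \<Rightarrow> bool"
    by (metis bij_unrank bij_pointE)
  have mult: "h (real_mat N *v x) = real_mat N' *v h x" for x
  proof -
    have "(\<Sum>j\<in>UNIV. real_of_int (N $ i $ unrank j) * x $ unrank j) = (\<Sum>j\<in>UNIV. real_of_int (N $ i $ j) * x $ j)" for i
      by (rule sum.reindex_bij_betw[OF bij_unrank, of "\<lambda>j. real_of_int (N $ i $ j) * x $ j"])
    then show ?thesis
      by (simp add: h_def N'_def vec_eq_iff matrix_vector_mult_def real_mat_def)
  qed
  have "matrix_inv (real_mat N') *v h y = h (matrix_inv (real_mat N) *v y)" for y
    by (metis mult matrix_inv_cancel[OF inv] matrix_inv_cancel[OF inv'])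
  moreover have "h x \<in> unit_cube \<longleftrightarrow> x \<in> unit_cube" for x
    unfolding unit_cube_def h_def using all[of "\<lambda>j. 0 \<le> x $ j \<and> x $ j < 1"] by simp
  moreover have "real_vec (g \<xi>) = h (real_vec \<xi>)" for \<xi>
    by (simp add: g_def h_def real_vec_def vec_eq_iff)
  ultimately have mem: "g \<xi> \<in> R' \<longleftrightarrow> \<xi> \<in> R" for \<xi>
    by (simp add: R_def R'_def)
  have "bij g"
  proof (rule o_bij)
    show "(\<lambda>v. \<chi> j. v $ mk_ranked j) \<circ> g = id" by (simp add: fun_eq_iff g_def mk_ranked_inverse)
    show "g \<circ> (\<lambda>v. \<chi> j. v $ mk_ranked j) = id" by (simp add: fun_eq_iff g_def unrank_inverse)
  qed
  have bij: "bij_betw g R R'"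
  proof (rule bij_betw_imageI)
    show "inj_on g R" using \<open>bij g\<close> by (meson bij_is_inj inj_on_subset subset_UNIV)
    show "g ` R = R'"
    proof (intro equalityI subsetI)
      fix y assume "y \<in> R'"
      moreover obtain x where "y = g x" using \<open>bij g\<close> by (meson bij_pointE)
      ultimately show "y \<in> g ` R" using mem by blast
    qed (use mem in auto)
  qed
  show "finite R" "card R = nat \<bar>det N\<bar>"
    using card_lattice_points_of_parallelepiped_wellorder[OF inv'] bij
    unfolding R'_def[symmetric] det by (auto simp: bij_betw_finite bij_betw_same_card)
qed

section \<open>Orthogonality of characters\<close>

lemma monom_int_exp:
  "monom_int (\<chi> j. exp (w $ j)) \<eta> = exp_powr w (real_vec \<eta>)"
  by (simp add: monom_int_def exp_powr_def exp_power_int exp_sum real_vec_def mult.commute)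

lemma monom_int_mult: "monom_int (x * y) \<eta> = monom_int x \<eta> * monom_int y \<eta>"
  by (simp add: monom_int_def power_int_mult_distrib prod.distrib)

definition Xi_vec :: "int^'n^'n \<Rightarrow> int^'n \<Rightarrow> complex^'n" where
  "Xi_vec M \<xi> = (\<chi> j. exp (2 * complex_of_real pi * \<i> *
       complex_of_real ((transpose (matrix_inv (real_mat M)) *v real_vec \<xi>) $ j)))"

lemma Xi_eq: "Xi M = range (Xi_vec M)"
  by (simp add: Xi_def Xi_vec_def)

lemma Xi_vec_add: "Xi_vec M (\<xi> + \<zeta>) = Xi_vec M \<xi> * Xi_vec M \<zeta>"
  by (simp add: Xi_vec_def vec_eq_iff real_vec_arith matrix_vector_right_distrib distrib_left flip: exp_add)

lemma Xi_vec_0: "Xi_vec M 0 = 1"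
  by (simp add: Xi_vec_def vec_eq_iff real_vec_arith)

lemma monom_int_Xi_vec:
  "monom_int (Xi_vec M \<xi>) \<eta> =
     exp (2 * pi * \<i> * complex_of_real (real_vec \<xi> \<bullet> (matrix_inv (real_mat M) *v real_vec \<eta>)))"
proof -
  let ?B = "matrix_inv (real_mat M)"
  have "monom_int (Xi_vec M \<xi>) \<eta> =
      exp (2 * pi * \<i> * complex_of_real ((transpose ?B *v real_vec \<xi>) \<bullet> real_vec \<eta>))"
    unfolding Xi_vec_def
    using monom_int_exp[of "\<chi> j. 2 * complex_of_real pi * \<i> * complex_of_real ((transpose ?B *v real_vec \<xi>) $ j)" \<eta>]
    by (simp add: exp_powr_def inner_vec_def sum_distrib_left mult.assoc)
  also have "(transpose ?B *v real_vec \<xi>) \<bullet> real_vec \<eta> = real_vec \<xi> \<bullet> (?B *v real_vec \<eta>)"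
    by (metis dot_lmul_matrix inner_commute transpose_matrix_vector)
  finally show ?thesis .
qed

lemma exp_2pi_eq_1_iff: "exp (2 * pi * \<i> * complex_of_real x) = 1 \<longleftrightarrow> x \<in> \<int>"
proof
  assume "exp (2 * pi * \<i> * complex_of_real x) = 1"
  then obtain n :: int where "2 * pi * x = of_int (2 * n) * pi"
    by (auto simp: exp_eq_1)
  then have "x = of_int n" by simp
  then show "x \<in> \<int>" by simp
qed (auto elim!: Ints_cases simp: exp_eq_1)

text \<open>The elements of \<open>Xi M\<close> are the characters of \<open>\<int>\<^sup>n / M \<int>\<^sup>n\<close>. The frequency vectors \<open>\<xi>\<close> with \<open>M\<^bsup>-T\<^esup>\<xi>\<close>
  in the half-open unit cube represent every coset of \<open>M\<^sup>T \<int>\<^sup>n\<close> exactly once, and hence every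
  character exactly once.\<close>

lemma card_Xi:
  fixes M :: "int^'n^'n"
  assumes inv: "invertible (real_mat M)"
  shows "finite (Xi M)" "card (Xi M) = nat \<bar>det M\<bar>"
proof -
  define N where "N = transpose M"
  let ?B = "transpose (matrix_inv (real_mat M))"
  have t: "real_mat N = transpose (real_mat M)"
    by (simp add: N_def real_mat_def transpose_def vec_eq_iff)
  have invN: "invertible (real_mat N)" unfolding t using inv by (rule transpose_invertible)
  have cM: "matrix_inv (real_mat M) ** real_mat M = mat 1"
    using matrix_inv_cancel(2)[OF inv] by (simp add: matrix_eq flip: matrix_vector_mul_assoc)
  then have tB: "real_mat N ** ?B = mat 1"
    unfolding t matrix_transpose_mul[symmetric] by (simp add: transpose_mat)
  have B: "?B *v x = matrix_inv (real_mat N) *v x" for x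
    by (metis tB matrix_inv_cancel(2)[OF invN] matrix_vector_mul_assoc matrix_vector_mul_lid)
  define R where "R = {\<xi>::int^'n. ?B *v real_vec \<xi> \<in> unit_cube}"
  have R: "finite R" "card R = nat \<bar>det M\<bar>"
    using card_lattice_points_of_parallelepiped[OF invN] unfolding R_def B N_def by (simp_all add: det_transpose)
  have "bij_betw (Xi_vec M) R (Xi M)"
  proof (rule bij_betwI')
    fix \<xi> \<zeta> assume R: "\<xi> \<in> R" "\<zeta> \<in> R"
    show "Xi_vec M \<xi> = Xi_vec M \<zeta> \<longleftrightarrow> \<xi> = \<zeta>"
    proof
      assume eq: "Xi_vec M \<xi> = Xi_vec M \<zeta>"
      have "(?B *v real_vec \<xi>) $ j = (?B *v real_vec \<zeta>) $ j" for j
      proof -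
        let ?x = "(?B *v real_vec \<xi>) $ j" and ?y = "(?B *v real_vec \<zeta>) $ j"
        have "exp (2 * pi * \<i> * complex_of_real (?x - ?y)) = 1"
          using arg_cong[OF eq, of "\<lambda>v. v $ j"] by (simp add: Xi_vec_def right_diff_distrib exp_diff)
        then obtain n where n: "?x - ?y = of_int n"
          unfolding exp_2pi_eq_1_iff by (elim Ints_cases)
        have "0 \<le> ?x" "?x < 1" "0 \<le> ?y" "?y < 1" using R unfolding R_def unit_cube_def by blast+
        with n have "n = 0" by linarith
        with n show ?thesis by simp
      qed
      then have "?B *v real_vec \<xi> = ?B *v real_vec \<zeta>" by (simp add: vec_eq_iff)
      then have "real_vec \<xi> = real_vec \<zeta>"
        unfolding B by (metis matrix_inv_cancel(1)[OF invN])
      then show "\<xi> = \<zeta>" by (simp add: real_vec_inject)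
    qed simp
  next
    show "Xi_vec M \<xi> \<in> Xi M" for \<xi> by (simp add: Xi_eq)
  next
    fix \<epsilon> assume "\<epsilon> \<in> Xi M"
    then obtain \<xi> where \<xi>: "\<epsilon> = Xi_vec M \<xi>" by (auto simp: Xi_eq)
    define \<zeta> where "\<zeta> = \<xi> - N *v floor_vec (?B *v real_vec \<xi>)"
    have "?B *v real_vec \<zeta> = ?B *v real_vec \<xi> - real_vec (floor_vec (?B *v real_vec \<xi>))"
      unfolding \<zeta>_def real_vec_arith real_mat_vec matrix_vector_mult_diff_distrib B
      by (simp add: matrix_inv_cancel[OF invN])
    then have "\<zeta> \<in> R" unfolding R_def by (simp add: diff_in_unit_cube_iff)
    moreover have "Xi_vec M (N *v \<beta>) = 1" for \<beta>
    proof -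
      have "?B *v real_vec (N *v \<beta>) = real_vec \<beta>"
        unfolding real_mat_vec B by (simp add: matrix_inv_cancel[OF invN])
      then show ?thesis using exp_2pi_eq_1_iff[of "real_of_int n" for n]
        by (simp add: Xi_vec_def vec_eq_iff real_vec_arith)
    qed
    then have "Xi_vec M \<xi> = Xi_vec M \<zeta>"
      using Xi_vec_add[of M \<zeta> "N *v floor_vec (?B *v real_vec \<xi>)"] by (simp add: \<zeta>_def)
    ultimately show "\<exists>\<zeta>\<in>R. \<epsilon> = Xi_vec M \<zeta>" using \<xi> by blast
  qed
  with R show "finite (Xi M)" "card (Xi M) = nat \<bar>det M\<bar>"
    by (auto simp: bij_betw_finite bij_betw_same_card)
qed

text \<open>Orthogonality of characters, which isolates one coset of \<open>M \<int>\<^sup>n\<close>. If \<open>\<eta>\<close> lies outside \<open>M \<int>\<^sup>n\<close>, some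
  coordinate of \<open>M\<^bsup>-1\<^esup>\<eta>\<close> is not an integer, and the character \<open>\<delta>\<close> of the corresponding unit vector
  has \<open>\<delta>\<^sup>\<eta> \<noteq> 1\<close>. Multiplication by \<open>\<delta>\<close> permutes the characters and multiplies the sum by \<open>\<delta>\<^sup>\<eta>\<close>.\<close>

lemma sum_Xi_monom_int:
  fixes M :: "int^'n^'n"
  assumes inv: "invertible (real_mat M)"
  shows "(\<Sum>\<epsilon>\<in>Xi M. monom_int \<epsilon> \<eta>) = (if \<eta> \<in> range ((*v) M) then of_int \<bar>det M\<bar> else 0)"
proof (cases "\<eta> \<in> range ((*v) M)")
  case True
  then obtain \<beta> where \<beta>: "\<eta> = M *v \<beta>" by auto
  have "monom_int \<epsilon> \<eta> = 1" if \<epsilon>: "\<epsilon> \<in> Xi M" for \<epsilon>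
  proof -
    obtain \<xi> where \<xi>: "\<epsilon> = Xi_vec M \<xi>" using \<epsilon> by (auto simp: Xi_eq)
    have "real_vec \<xi> \<bullet> real_vec \<beta> \<in> \<int>"
      unfolding inner_vec_def real_vec_def by (intro Ints_sum) auto
    then show ?thesis
      unfolding \<xi> \<beta> monom_int_Xi_vec real_mat_vec matrix_inv_cancel[OF inv] exp_2pi_eq_1_iff .
  qed
  then show ?thesis using True card_Xi[OF inv] by simp
next
  case False
  let ?x = "matrix_inv (real_mat M) *v real_vec \<eta>"
  have "\<exists>j. ?x $ j \<notin> \<int>"
  proof (rule ccontr)
    assume "\<nexists>j. ?x $ j \<notin> \<int>"
    then have "\<forall>j. ?x $ j = real_of_int \<lfloor>?x $ j\<rfloor>"
      by (metis Ints_cases floor_of_int)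
    then have "real_vec (floor_vec ?x) = ?x"
      by (simp add: real_vec_def floor_vec_def vec_eq_iff)
    then have "real_vec (M *v floor_vec ?x) = real_vec \<eta>"
      unfolding real_mat_vec by (simp add: matrix_inv_cancel[OF inv])
    then have "M *v floor_vec ?x = \<eta>" by (simp add: real_vec_inject)
    then show False using False by (metis rangeI)
  qed
  then obtain j where j: "?x $ j \<notin> \<int>" by blast
  define \<delta> where "\<delta> = Xi_vec M (axis j 1)"
  have "real_vec (axis j 1) = axis j (1::real)"
    by (simp add: real_vec_def axis_def vec_eq_iff)
  then have ne: "monom_int \<delta> \<eta> \<noteq> 1"
    unfolding \<delta>_def monom_int_Xi_vec exp_2pi_eq_1_iff using j by (simp add: inner_axis')
  have "bij_betw (\<lambda>\<epsilon>. \<delta> * \<epsilon>) (Xi M) (Xi M)"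
  proof (rule bij_betwI[where g = "\<lambda>\<epsilon>. Xi_vec M (- axis j 1) * \<epsilon>"])
    have one: "Xi_vec M (- axis j 1) * \<delta> = 1"
      unfolding \<delta>_def Xi_vec_add[symmetric] by (simp add: Xi_vec_0)
    show "\<And>x. x \<in> Xi M \<Longrightarrow> Xi_vec M (- axis j 1) * (\<delta> * x) = x"
      "\<And>x. x \<in> Xi M \<Longrightarrow> \<delta> * (Xi_vec M (- axis j 1) * x) = x"
      using one by (metis mult.assoc mult.commute mult_1)+
  qed (auto simp: Xi_eq \<delta>_def simp flip: Xi_vec_add)
  then have "(\<Sum>\<epsilon>\<in>Xi M. monom_int \<epsilon> \<eta>) = (\<Sum>\<epsilon>\<in>Xi M. monom_int (\<delta> * \<epsilon>) \<eta>)"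
    by (rule sum.reindex_bij_betw[symmetric])
  also have "\<dots> = monom_int \<delta> \<eta> * (\<Sum>\<epsilon>\<in>Xi M. monom_int \<epsilon> \<eta>)"
    by (simp add: monom_int_mult sum_distrib_left)
  finally have "(\<Sum>\<epsilon>\<in>Xi M. monom_int \<epsilon> \<eta>) = 0" using ne by simp
  then show ?thesis using False by simp
qed

section \<open>Derivatives of symbols as factorial moments\<close>

lemma monom_nat_update:
  "monom_nat (\<chi> i. if i = j then w else z $ i) e = w ^ (e $ j) * (\<Prod>i\<in>UNIV - {j}. z $ i ^ (e $ i))"
proof -
  have "monom_nat (\<chi> i. if i = j then w else z $ i) e =
      w ^ (e $ j) * (\<Prod>i\<in>UNIV - {j}. (if i = j then w else z $ i) ^ (e $ i))"
    unfolding monom_nat_def by (subst prod.remove[of _ j]) auto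
  also have "(\<Prod>i\<in>UNIV - {j}. (if i = j then w else z $ i) ^ (e $ i)) = (\<Prod>i\<in>UNIV - {j}. z $ i ^ (e $ i))"
    by (intro prod.cong) auto
  finally show ?thesis .
qed

lemma partial_sum_monom:
  fixes e :: "'b \<Rightarrow> nat^'n"
  shows "partial j (\<lambda>z. \<Sum>b\<in>S. c b * monom_nat z (e b)) =
    (\<lambda>z. \<Sum>b\<in>S. c b * of_nat (e b $ j) * monom_nat z (\<chi> i. if i = j then e b $ j - 1 else e b $ i))"
proof
  fix z :: "complex^'n"
  let ?r = "\<lambda>b. \<Prod>i\<in>UNIV - {j}. z $ i ^ (e b $ i)"
  have "((\<lambda>w. \<Sum>b\<in>S. c b * (w ^ (e b $ j) * ?r b)) has_field_derivative
      (\<Sum>b\<in>S. c b * (of_nat (e b $ j) * z $ j ^ (e b $ j - 1) * ?r b))) (at (z $ j))"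
    by (auto intro!: derivative_eq_intros sum.cong)
  then have "partial j (\<lambda>z. \<Sum>b\<in>S. c b * monom_nat z (e b)) z =
      (\<Sum>b\<in>S. c b * (of_nat (e b $ j) * z $ j ^ (e b $ j - 1) * ?r b))"
    unfolding partial_def monom_nat_update by (rule DERIV_imp_deriv)
  also have "\<dots> = (\<Sum>b\<in>S. c b * of_nat (e b $ j) * monom_nat z (\<chi> i. if i = j then e b $ j - 1 else e b $ i))"
  proof (intro sum.cong refl)
    fix b
    have "monom_nat z (\<chi> i. if i = j then e b $ j - 1 else e b $ i) = z $ j ^ (e b $ j - 1) * ?r b"
      unfolding monom_nat_def by (subst prod.remove[of _ j]) (auto intro: prod.cong)
    then show "c b * (of_nat (e b $ j) * z $ j ^ (e b $ j - 1) * ?r b) =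
      c b * of_nat (e b $ j) * monom_nat z (\<chi> i. if i = j then e b $ j - 1 else e b $ i)" by simp
  qed
  finally show "partial j (\<lambda>z. \<Sum>b\<in>S. c b * monom_nat z (e b)) z = \<dots>" .
qed

definition falling :: "real \<Rightarrow> nat \<Rightarrow> real" where
  "falling x n = (\<Prod>i<n. x - real i)"

lemma falling_of_nat_eq_0: "m < n \<Longrightarrow> falling (real m) n = 0"
  unfolding falling_def by (intro prod_zero) auto

lemma falling_Suc_of_nat: "falling (real m) (Suc n) = falling (real m) n * real (m - n)"
  by (cases "n \<le> m") (auto simp: falling_of_nat_eq_0, simp add: falling_def of_nat_diff)

lemma partial_funpow_sum_monom:
  fixes e :: "'b \<Rightarrow> nat^'n"
  shows "(partial j ^^ n) (\<lambda>z. \<Sum>b\<in>S. c b * monom_nat z (e b)) =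
    (\<lambda>z. \<Sum>b\<in>S. c b * of_real (falling (real (e b $ j)) n) *
       monom_nat z (\<chi> i. if i = j then e b $ j - n else e b $ i))"
proof (induction n)
  case 0
  have "(\<chi> i. if i = j then e b $ j - 0 else e b $ i) = e b" for b by (simp add: vec_eq_iff)
  then show ?case by (simp add: falling_def)
next
  case (Suc n)
  let ?e = "\<lambda>b. \<chi> i. if i = j then e b $ j - n else e b $ i"
  have eq: "(\<chi> i. if i = j then ?e b $ j - 1 else ?e b $ i) = (\<chi> i. if i = j then e b $ j - Suc n else e b $ i)" for b
    by (simp add: vec_eq_iff)
  show ?case
    unfolding funpow.simps comp_def Suc partial_sum_monom falling_Suc_of_nat eq
    by (simp add: mult.assoc)
qed

lemma foldr_partial_sum_monom:
  fixes e :: "'b \<Rightarrow> nat^'n"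
  assumes "distinct js"
  shows "foldr (\<lambda>j. partial j ^^ (\<gamma> $ j)) js (\<lambda>z. \<Sum>b\<in>S. c b * monom_nat z (e b)) =
    (\<lambda>z. \<Sum>b\<in>S. c b * of_real (\<Prod>j\<in>set js. falling (real (e b $ j)) (\<gamma> $ j)) *
       monom_nat z (\<chi> i. if i \<in> set js then e b $ i - \<gamma> $ i else e b $ i))"
  using assms
proof (induction js)
  case (Cons j js)
  then have j: "j \<notin> set js" by simp
  let ?e = "\<lambda>b. \<chi> i. if i \<in> set js then e b $ i - \<gamma> $ i else e b $ i"
  have eq: "(\<chi> i. if i = j then ?e b $ j - \<gamma> $ j else ?e b $ i) =
      (\<chi> i. if i \<in> set (j # js) then e b $ i - \<gamma> $ i else e b $ i)" for b
    using j by (simp add: vec_eq_iff)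
  have ej: "?e b $ j = e b $ j" for b using j by simp
  have IH: "foldr (\<lambda>j. partial j ^^ (\<gamma> $ j)) js (\<lambda>z. \<Sum>b\<in>S. c b * monom_nat z (e b)) =
      (\<lambda>z. \<Sum>b\<in>S. c b * of_real (\<Prod>j\<in>set js. falling (real (e b $ j)) (\<gamma> $ j)) * monom_nat z (?e b))"
    using Cons by simp
  have prod: "(\<Prod>j\<in>set (j # js). falling (real (e b $ j)) (\<gamma> $ j)) =
      (\<Prod>j\<in>set js. falling (real (e b $ j)) (\<gamma> $ j)) * falling (real (e b $ j)) (\<gamma> $ j)" for b
    using j by (simp add: mult.commute)
  show ?case
    unfolding foldr.simps comp_def IH partial_funpow_sum_monom eq
    unfolding ej prod
    by (simp only: of_real_mult mult.assoc)
qed simp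

lemma multi_deriv_sum_monom:
  fixes e :: "'b \<Rightarrow> nat^'n"
  shows "multi_deriv \<gamma> (\<lambda>z. \<Sum>b\<in>S. c b * monom_nat z (e b)) z =
    (\<Sum>b\<in>S. c b * of_real (q_poly \<gamma> (\<chi> j. real (e b $ j))) * monom_nat z (e b - \<gamma>))"
proof -
  have "distinct (coord_list :: 'n list) \<and> set (coord_list :: 'n list) = UNIV"
    unfolding coord_list_def by (rule someI_ex) (metis finite_distinct_list finite)
  then show ?thesis
    unfolding multi_deriv_def
    by (simp add: foldr_partial_sum_monom q_poly_def falling_def minus_vec_def)
qed

text \<open>The operator \<open>z\<^sup>\<gamma> D\<^sup>\<gamma>\<close> multiplies the monomial \<open>z\<^sup>\<alpha>\<close> by \<open>q\<^sub>\<gamma>(\<alpha>)\<close>. So the derivative conditions on a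
  symbol are conditions on the moments of its weights \<open>a\<^sub>\<alpha> z\<^sup>\<alpha>\<close> against the polynomials \<open>q\<^sub>\<gamma>\<close>.\<close>

lemma monom_nat_mult_multi_deriv_symbol:
  fixes a :: "int^'n \<Rightarrow> real"
  assumes "mask_supported a"
  shows "monom_nat z \<gamma> * multi_deriv \<gamma> (mask_symbol a) z =
    (\<Sum>\<alpha> | a \<alpha> \<noteq> 0. complex_of_real (a \<alpha>) * monom_int z \<alpha> * of_real (q_poly \<gamma> (real_vec \<alpha>)))"
proof -
  define e :: "int^'n \<Rightarrow> nat^'n" where "e \<alpha> = (\<chi> j. nat (\<alpha> $ j))" for \<alpha>
  have nonneg: "\<alpha> $ j \<ge> 0" if "a \<alpha> \<noteq> 0" for \<alpha> j
    using assms that unfolding mask_supported_def by blast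
  have mono: "monom_int w \<alpha> = monom_nat w (e \<alpha>)" if "a \<alpha> \<noteq> 0" for \<alpha> w
    unfolding monom_int_def monom_nat_def e_def
    using nonneg[OF that] by (intro prod.cong) (simp_all add: power_int_def)
  have real: "(\<chi> j. real (e \<alpha> $ j)) = real_vec \<alpha>" if "a \<alpha> \<noteq> 0" for \<alpha>
    using nonneg[OF that] by (simp add: vec_eq_iff e_def real_vec_def)
  have sym: "mask_symbol a = (\<lambda>z. \<Sum>\<alpha> | a \<alpha> \<noteq> 0. complex_of_real (a \<alpha>) * monom_nat z (e \<alpha>))"
    unfolding mask_symbol_def by (intro ext sum.cong) (auto simp: mono)
  (* Truncated exponents do no harm: q_poly vanishes if some d $ j is below \<gamma> $ j. *)
  have shift: "monom_nat z \<gamma> * (of_real (q_poly \<gamma> (\<chi> j. real (d $ j))) * monom_nat z (d - \<gamma>)) =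
      of_real (q_poly \<gamma> (\<chi> j. real (d $ j))) * monom_nat z d" for d
  proof (cases "\<forall>j. \<gamma> $ j \<le> d $ j")
    case True
    then have "monom_nat z \<gamma> * monom_nat z (d - \<gamma>) = monom_nat z d"
      unfolding monom_nat_def prod.distrib[symmetric] by (simp flip: power_add)
    then show ?thesis by (simp add: mult.left_commute)
  next
    case False
    then obtain j where "d $ j < \<gamma> $ j" by (auto simp: not_le)
    then have "q_poly \<gamma> (\<chi> j. real (d $ j)) = 0"
      unfolding q_poly_def using falling_of_nat_eq_0[of "d $ j" "\<gamma> $ j"]
      by (intro prod_zero bexI[of _ j]) (simp_all add: falling_def)
    then show ?thesis by simp
  qed
  show ?thesis
    unfolding sym multi_deriv_sum_monom sum_distrib_left
  proof (intro sum.cong refl)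
    fix \<alpha> assume "\<alpha> \<in> {\<alpha>. a \<alpha> \<noteq> 0}"
    then have \<alpha>: "a \<alpha> \<noteq> 0" by simp
    show "monom_nat z \<gamma> * (complex_of_real (a \<alpha>) * of_real (q_poly \<gamma> (\<chi> j. real (e \<alpha> $ j))) * monom_nat z (e \<alpha> - \<gamma>)) =
      complex_of_real (a \<alpha>) * monom_int z \<alpha> * of_real (q_poly \<gamma> (real_vec \<alpha>))"
      using arg_cong[OF shift[of "e \<alpha>"], of "\<lambda>x. complex_of_real (a \<alpha>) * x"]
      unfolding mono[OF \<alpha>] real[OF \<alpha>] by (simp add: ac_simps)
  qed
qed

section \<open>Polynomials spanned by monomials\<close>

definition real_monom :: "nat^'n \<Rightarrow> real^'n \<Rightarrow> complex" where
  "real_monom \<gamma> x = monom_nat (\<chi> j. complex_of_real (x $ j)) \<gamma>"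

lemma real_monom_eq: "real_monom \<gamma> x = (\<Prod>j\<in>UNIV. complex_of_real (x $ j) ^ (\<gamma> $ j))"
  by (simp add: real_monom_def monom_nat_def)

text \<open>Dedekind's argument: monomials are distinct multiplicative functions for the componentwise
  product. Replacing \<open>x\<close> by \<open>y * x\<close> in the relation and subtracting a multiple of the original
  relation removes the term of \<open>\<delta>\<close>, while a suitable \<open>y\<close> keeps the coefficient under consideration.\<close>

lemma real_monom_independent:
  fixes c :: "nat^'n \<Rightarrow> complex"
  assumes "finite S" "\<And>x. (\<Sum>\<gamma>\<in>S. c \<gamma> * real_monom \<gamma> x) = 0" "\<gamma> \<in> S"
  shows "c \<gamma> = 0"
  using assms
proof (induction S arbitrary: c \<gamma> rule: finite_induct)
  case (insert \<delta> S)
  have S: "c \<gamma> = 0" if g: "\<gamma> \<in> S" for \<gamma>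
  proof -
    from g insert.hyps have "\<gamma> \<noteq> \<delta>" by auto
    then obtain j where j: "\<gamma> $ j \<noteq> \<delta> $ j" by (auto simp: vec_eq_iff)
    define y :: "real^'n" where "y = (\<chi> i. if i = j then 2 else 1)"
    have "complex_of_real (y $ i) ^ k = (if i = j then 2 ^ k else 1)" for i k by (simp add: y_def)
    then have y: "real_monom \<gamma> y = 2 ^ (\<gamma> $ j)" for \<gamma> by (simp add: real_monom_eq)
    have mult: "real_monom \<gamma> (y * x) = real_monom \<gamma> y * real_monom \<gamma> x" for \<gamma> x
      by (simp add: real_monom_eq power_mult_distrib prod.distrib)
    have "(\<Sum>\<gamma>\<in>S. (c \<gamma> * (real_monom \<gamma> y - real_monom \<delta> y)) * real_monom \<gamma> x) = 0" for x
    proof -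
      have "(\<Sum>\<gamma>\<in>S. (c \<gamma> * (real_monom \<gamma> y - real_monom \<delta> y)) * real_monom \<gamma> x) =
          (\<Sum>\<gamma>\<in>insert \<delta> S. (c \<gamma> * (real_monom \<gamma> y - real_monom \<delta> y)) * real_monom \<gamma> x)"
        using insert.hyps by simp
      also have "\<dots> = (\<Sum>\<gamma>\<in>insert \<delta> S. c \<gamma> * real_monom \<gamma> (y * x)) -
          real_monom \<delta> y * (\<Sum>\<gamma>\<in>insert \<delta> S. c \<gamma> * real_monom \<gamma> x)"
        unfolding sum_distrib_left sum_subtractf[symmetric] mult
        by (intro sum.cong) (auto simp: algebra_simps)
      also have "\<dots> = 0" using insert.prems(1) by simp
      finally show ?thesis .
    qed
    from insert.IH[OF this g] have "c \<gamma> * (2 ^ (\<gamma> $ j) - 2 ^ (\<delta> $ j)) = 0" by (simp add: y)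
    moreover have "(2::complex) ^ (\<gamma> $ j) \<noteq> 2 ^ (\<delta> $ j)"
    proof
      assume "(2::complex) ^ (\<gamma> $ j) = 2 ^ (\<delta> $ j)"
      then have "norm ((2::complex) ^ (\<gamma> $ j)) = norm ((2::complex) ^ (\<delta> $ j))" by simp
      then show False using j by (simp add: norm_power)
    qed
    ultimately show ?thesis by simp
  qed
  have "c \<delta> * real_monom \<delta> 1 = 0" using insert.prems(1)[of 1] insert.hyps S by simp
  then have "c \<delta> = 0" by (simp add: real_monom_eq)
  with S insert.prems(2) show ?case by blast
qed simp

definition box_below :: "nat^'n \<Rightarrow> (nat^'n) set" where
  "box_below \<gamma> = {\<delta>. \<forall>j. \<delta> $ j \<le> \<gamma> $ j}"

text \<open>Product expansion in vector form. It serves for the binomial theorem and for the passage from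
  powers to falling factorials, both in several variables.\<close>

lemma prod_sum_box_below:
  fixes f :: "'n::finite \<Rightarrow> nat \<Rightarrow> 'a::comm_semiring_1"
  shows "(\<Prod>j\<in>UNIV. \<Sum>k\<le>\<gamma> $ j. f j k) = (\<Sum>\<delta>\<in>box_below \<gamma>. \<Prod>j\<in>UNIV. f j (\<delta> $ j))"
    and "finite (box_below \<gamma>)"
proof -
  have bij: "bij_betw (\<lambda>g. \<chi> j. g j) (PiE UNIV (\<lambda>j. {..\<gamma> $ j})) (box_below \<gamma>)"
    by (rule bij_betwI[where g = vec_nth]) (simp_all add: box_below_def PiE_iff Pi_iff fun_eq_iff)
  show "finite (box_below \<gamma>)"
    using bij_betw_finite[OF bij] finite_PiE[of UNIV "\<lambda>j. {..\<gamma> $ j}"] by simp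
  show "(\<Prod>j\<in>UNIV. \<Sum>k\<le>\<gamma> $ j. f j k) = (\<Sum>\<delta>\<in>box_below \<gamma>. \<Prod>j\<in>UNIV. f j (\<delta> $ j))"
    using sum.reindex_bij_betw[OF bij, of "\<lambda>\<delta>. \<Prod>j\<in>UNIV. f j (\<delta> $ j)"]
    by (simp add: prod_sum_PiE)
qed

lemma EP_polynomial_cases:
  assumes "p \<in> EP \<Gamma> {0}"
  obtains T c where "finite T" "T \<subseteq> \<Gamma>" "\<And>x. p x = (\<Sum>\<gamma>\<in>T. c \<gamma> * real_monom \<gamma> x)"
proof -
  obtain U d where U: "finite U" "U \<subseteq> \<Gamma> \<times> {0}"
    and p: "p = (\<lambda>x. \<Sum>(\<gamma>, lam)\<in>U. d (\<gamma>, lam) * exp_monom \<gamma> lam x)"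
    using assms unfolding EP_def by blast
  have inj: "inj_on fst U" using U(2) by (auto intro!: inj_onI)
  have "p x = (\<Sum>\<gamma>\<in>fst ` U. d (\<gamma>, 0) * real_monom \<gamma> x)" for x
    unfolding p sum.reindex[OF inj] using U(2)
    by (intro sum.cong) (auto simp: exp_monom_def real_monom_def exp_powr_def)
  with U show thesis by (intro that[of "fst ` U" "\<lambda>\<gamma>. d (\<gamma>, 0)"]) auto
qed

lemma exp_monom_in_EP: "\<gamma> \<in> \<Gamma> \<Longrightarrow> exp_monom \<gamma> lam \<in> EP \<Gamma> {lam}"
  unfolding EP_def by (auto intro!: exI[of _ "{(\<gamma>, lam)}"] exI[of _ "\<lambda>_. 1"])

text \<open>In the expansion of \<open>(x + 1)\<^sup>\<gamma>\<close> every monomial below \<open>\<gamma>\<close> occurs with a nonzero binomial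
  coefficient. By translation invariance and linear independence all of them come from \<open>\<Gamma>\<close>.\<close>

lemma invariant_exponents_downward_closed:
  assumes inv: "invariant_exponents M \<Gamma>" and "\<gamma> \<in> \<Gamma>" "\<delta> \<in> box_below \<gamma>"
  shows "\<delta> \<in> \<Gamma>"
proof -
  have "(\<lambda>x. exp_monom \<gamma> 0 (x + 1)) \<in> EP \<Gamma> {0}"
    using inv exp_monom_in_EP[OF assms(2)] unfolding invariant_exponents_def by blast
  then obtain T c where T: "finite T" "T \<subseteq> \<Gamma>"
    and c: "\<And>x. exp_monom \<gamma> 0 (x + 1) = (\<Sum>\<delta>\<in>T. c \<delta> * real_monom \<delta> x)"
    by (elim EP_polynomial_cases) blast
  define b where "b \<delta> = (\<Prod>j\<in>UNIV. of_nat (\<gamma> $ j choose \<delta> $ j) :: complex)" for \<delta>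
  have "exp_monom \<gamma> 0 (x + 1) = (\<Sum>\<delta>\<in>box_below \<gamma>. b \<delta> * real_monom \<delta> x)" for x
  proof -
    have "exp_monom \<gamma> 0 (x + 1) = (\<Prod>j\<in>UNIV. \<Sum>k\<le>\<gamma> $ j. of_nat (\<gamma> $ j choose k) * complex_of_real (x $ j) ^ k)"
      by (simp add: exp_monom_def exp_powr_def monom_nat_def binomial_ring)
    then show ?thesis
      unfolding prod_sum_box_below by (simp add: b_def real_monom_eq prod.distrib)
  qed
  note b = this
  let ?D = "box_below \<gamma>"
  have fin: "finite (T \<union> ?D)" using T prod_sum_box_below(2) by auto
  have "(\<Sum>\<delta>\<in>T \<union> ?D. ((if \<delta> \<in> ?D then b \<delta> else 0) - (if \<delta> \<in> T then c \<delta> else 0)) * real_monom \<delta> x) = 0" for x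
  proof -
    have "(\<Sum>\<delta>\<in>T \<union> ?D. ((if \<delta> \<in> ?D then b \<delta> else 0) - (if \<delta> \<in> T then c \<delta> else 0)) * real_monom \<delta> x) =
      (\<Sum>\<delta>\<in>T \<union> ?D. if \<delta> \<in> ?D then b \<delta> * real_monom \<delta> x else 0) -
      (\<Sum>\<delta>\<in>T \<union> ?D. if \<delta> \<in> T then c \<delta> * real_monom \<delta> x else 0)"
      unfolding sum_subtractf[symmetric] by (intro sum.cong) (auto simp: algebra_simps)
    also have "\<dots> = (\<Sum>\<delta>\<in>?D. b \<delta> * real_monom \<delta> x) - (\<Sum>\<delta>\<in>T. c \<delta> * real_monom \<delta> x)"
      using fin by (simp add: sum.If_cases Int_absorb1)
    finally show ?thesis using b[of x] c[of x] by simp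
  qed
  from real_monom_independent[OF fin this, of \<delta>]
  have "b \<delta> = (if \<delta> \<in> T then c \<delta> else 0)" using assms(3) by simp
  moreover have "b \<delta> \<noteq> 0"
    using assms(3) by (simp add: b_def box_below_def not_less)
  ultimately show ?thesis using T(2) by (auto split: if_splits)
qed

lemma power_eq_sum_Stirling_falling:
  "x ^ n = (\<Sum>k\<le>n. real (Stirling n k) * falling x k)"
proof (induction n)
  case (Suc n)
  have step: "x * (c * falling x k) = c * falling x (Suc k) + real k * c * falling x k" for c k
  proof -
    have "falling x (Suc k) = falling x k * (x - real k)" by (simp add: falling_def)
    then show ?thesis by (simp only:) (simp add: algebra_simps)
  qed
  have "x ^ Suc n = (\<Sum>k\<le>n. real (Stirling n k) * falling x (Suc k)) + (\<Sum>k\<le>n. real k * real (Stirling n k) * falling x k)"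
    unfolding power_Suc Suc sum_distrib_left sum.distrib[symmetric]
    by (simp only: step)
  also have "(\<Sum>k\<le>n. real k * real (Stirling n k) * falling x k) = (\<Sum>k\<le>Suc n. real k * real (Stirling n k) * falling x k)"
    by simp
  also have "\<dots> = (\<Sum>k\<le>n. real (Suc k) * real (Stirling n (Suc k)) * falling x (Suc k))"
    unfolding sum.atMost_Suc_shift by simp
  finally show ?case
    unfolding sum.atMost_Suc_shift by (simp add: sum.distrib distrib_right add.commute)
qed (simp add: falling_def)

lemma real_monom_eq_sum_q_poly:
  "real_monom \<gamma> x = (\<Sum>\<delta>\<in>box_below \<gamma>.
     complex_of_real (\<Prod>j\<in>UNIV. real (Stirling (\<gamma> $ j) (\<delta> $ j))) * complex_of_real (q_poly \<delta> x))"
proof -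
  have "real_monom \<gamma> x = complex_of_real (\<Prod>j\<in>UNIV. x $ j ^ (\<gamma> $ j))"
    by (simp add: real_monom_eq)
  also have "(\<Prod>j\<in>UNIV. x $ j ^ (\<gamma> $ j)) =
     (\<Sum>\<delta>\<in>box_below \<gamma>. \<Prod>j\<in>UNIV. real (Stirling (\<gamma> $ j) (\<delta> $ j)) * falling (x $ j) (\<delta> $ j))"
    unfolding power_eq_sum_Stirling_falling by (rule prod_sum_box_below)
  finally show ?thesis
    by (simp add: prod.distrib q_poly_def falling_def)
qed

text \<open>Factorial moments determine power moments of the same exponents, because a power is a
  combination of the polynomials \<open>q\<^sub>\<delta>\<close> with \<open>\<delta>\<close> below its exponent.\<close>

lemma moments_of_real_monom:
  assumes down: "\<And>\<delta>. \<delta> \<in> box_below \<gamma> \<Longrightarrow> \<delta> \<in> \<Gamma>"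
    and q: "\<And>\<delta>. \<delta> \<in> \<Gamma> \<Longrightarrow> (\<Sum>b\<in>S. w b * complex_of_real (q_poly \<delta> (y b))) = C * complex_of_real (q_poly \<delta> \<sigma>)"
  shows "(\<Sum>b\<in>S. w b * real_monom \<gamma> (y b)) = C * real_monom \<gamma> \<sigma>"
proof -
  let ?s = "\<lambda>\<delta>. complex_of_real (\<Prod>j\<in>UNIV. real (Stirling (\<gamma> $ j) (\<delta> $ j)))"
  have "(\<Sum>b\<in>S. w b * real_monom \<gamma> (y b)) =
      (\<Sum>\<delta>\<in>box_below \<gamma>. ?s \<delta> * (\<Sum>b\<in>S. w b * complex_of_real (q_poly \<delta> (y b))))"
    unfolding real_monom_eq_sum_q_poly sum_distrib_left
    by (subst sum.swap) (simp add: mult.left_commute)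
  also have "\<dots> = (\<Sum>\<delta>\<in>box_below \<gamma>. ?s \<delta> * (C * complex_of_real (q_poly \<delta> \<sigma>)))"
    using down q by (intro sum.cong) auto
  also have "\<dots> = C * real_monom \<gamma> \<sigma>"
    unfolding real_monom_eq_sum_q_poly sum_distrib_left by (simp add: mult.left_commute)
  finally show ?thesis .
qed

section \<open>Exactness of one subdivision step\<close>

lemma finite_mask_support:
  fixes a :: "int^'n \<Rightarrow> real"
  assumes "mask_supported a"
  shows "finite {\<eta>. a \<eta> \<noteq> 0}"
proof -
  obtain N where N: "\<forall>\<eta>. a \<eta> \<noteq> 0 \<longrightarrow> (\<forall>j. 0 \<le> \<eta> $ j \<and> \<eta> $ j \<le> N)"
    using assms unfolding mask_supported_def by blast
  have "vec_nth ` {\<eta>. a \<eta> \<noteq> 0} \<subseteq> PiE UNIV (\<lambda>_. {0..N})" using N by auto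
  then have "finite (vec_nth ` {\<eta>. a \<eta> \<noteq> 0})"
    by (rule finite_subset) (simp add: finite_PiE)
  then show ?thesis by (rule finite_imageD) (simp add: inj_on_def vec_nth_inject)
qed

text \<open>Summing over \<open>\<eta> = \<alpha> - M\<beta>\<close> restricts \<open>\<eta>\<close> to the coset of \<open>\<alpha>\<close>; orthogonality of characters replaces
  this restriction by a sum over \<open>Xi M\<close>, whose inner sums run over the whole mask and are values of
  the kind that the derivative conditions describe.\<close>

lemma subdiv_op_reindex:
  fixes M :: "int^'n^'n"
  assumes inv: "invertible (real_mat M)" and fin: "finite {\<eta>. a \<eta> \<noteq> 0}"
    and F: "\<And>\<beta>. f \<beta> = F (\<alpha> - M *v \<beta>)"
  shows "of_int \<bar>det M\<bar> * subdiv_op M a f \<alpha> =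
    (\<Sum>\<epsilon>\<in>Xi M. \<Sum>\<eta> | a \<eta> \<noteq> 0. complex_of_real (a \<eta>) * monom_int \<epsilon> (\<eta> - \<alpha>) * F \<eta>)"
proof -
  let ?S = "{\<eta>. a \<eta> \<noteq> 0}" and ?m = "of_int \<bar>det M\<bar> :: complex"
  have inj: "inj (\<lambda>\<beta>. \<alpha> - M *v \<beta>)"
  proof (rule injI)
    fix \<beta> \<beta>' assume "\<alpha> - M *v \<beta> = \<alpha> - M *v \<beta>'"
    then have "real_mat M *v real_vec \<beta> = real_mat M *v real_vec \<beta>'"
      by (simp flip: real_mat_vec)
    then show "\<beta> = \<beta>'" using matrix_inv_cancel(2)[OF inv] by (metis real_vec_inject)
  qed
  have "?m * subdiv_op M a f \<alpha> =
      (\<Sum>\<eta> \<in> (\<lambda>\<beta>. \<alpha> - M *v \<beta>) ` {\<beta>. a (\<alpha> - M *v \<beta>) \<noteq> 0}. ?m * (complex_of_real (a \<eta>) * F \<eta>))"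
    unfolding subdiv_op_def sum_distrib_left F
    by (subst sum.reindex) (auto intro: inj_on_subset[OF inj])
  also have "(\<lambda>\<beta>. \<alpha> - M *v \<beta>) ` {\<beta>. a (\<alpha> - M *v \<beta>) \<noteq> 0} = {\<eta>\<in>?S. \<eta> - \<alpha> \<in> range ((*v) M)}"
  proof (intro equalityI subsetI)
    fix \<eta> assume "\<eta> \<in> (\<lambda>\<beta>. \<alpha> - M *v \<beta>) ` {\<beta>. a (\<alpha> - M *v \<beta>) \<noteq> 0}"
    then obtain \<beta> where "\<eta> = \<alpha> - M *v \<beta>" "a \<eta> \<noteq> 0" by auto
    moreover from this have "\<eta> - \<alpha> = M *v (- \<beta>)"
      by (simp add: vec_eq_iff matrix_vector_mult_def sum_negf)
    ultimately show "\<eta> \<in> {\<eta>\<in>?S. \<eta> - \<alpha> \<in> range ((*v) M)}" by blast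
  next
    fix \<eta> assume "\<eta> \<in> {\<eta>\<in>?S. \<eta> - \<alpha> \<in> range ((*v) M)}"
    then obtain \<beta> where "\<eta> - \<alpha> = M *v \<beta>" "a \<eta> \<noteq> 0" by auto
    moreover from this have "\<eta> = \<alpha> - M *v (- \<beta>)"
      by (simp add: vec_eq_iff matrix_vector_mult_def sum_negf algebra_simps)
    ultimately show "\<eta> \<in> (\<lambda>\<beta>. \<alpha> - M *v \<beta>) ` {\<beta>. a (\<alpha> - M *v \<beta>) \<noteq> 0}" by blast
  qed
  also have "(\<Sum>\<eta> \<in> {\<eta>\<in>?S. \<eta> - \<alpha> \<in> range ((*v) M)}. ?m * (complex_of_real (a \<eta>) * F \<eta>)) =
      (\<Sum>\<eta>\<in>?S. (\<Sum>\<epsilon>\<in>Xi M. monom_int \<epsilon> (\<eta> - \<alpha>)) * (complex_of_real (a \<eta>) * F \<eta>))"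
    unfolding sum_Xi_monom_int[OF inv] using fin
    by (subst sum.inter_filter) (simp_all add: if_distrib[of "\<lambda>x. x * _"] cong: if_cong)
  also have "\<dots> = (\<Sum>\<epsilon>\<in>Xi M. \<Sum>\<eta>\<in>?S. complex_of_real (a \<eta>) * monom_int \<epsilon> (\<eta> - \<alpha>) * F \<eta>)"
    unfolding sum_distrib_right by (subst sum.swap) (simp add: ac_simps)
  finally show ?thesis .
qed

lemma exp_powr_add: "exp_powr u (x + y) = exp_powr u x * exp_powr u y"
  by (simp add: exp_powr_def distrib_left sum.distrib exp_add)

lemma exp_powr_minus: "exp_powr u (- x) = exp_powr (- u) x"
  by (simp add: exp_powr_def)

lemma exp_powr_log_pt: "exp_powr (log_pt M k lam) y = exp_powr lam (- (Minv_pow M k *v y))"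
proof -
  have "(\<Sum>j\<in>UNIV. (\<Sum>i\<in>UNIV. lam $ i * complex_of_real (A $ i $ j)) * complex_of_real (y $ j)) =
      (\<Sum>i\<in>UNIV. lam $ i * (\<Sum>j\<in>UNIV. complex_of_real (A $ i $ j) * complex_of_real (y $ j)))" for A :: "real^'a^'a"
    unfolding sum_distrib_left sum_distrib_right by (subst sum.swap) (simp add: mult.assoc)
  then show ?thesis
    by (simp add: exp_powr_def log_pt_def vector_matrix_mult_def matrix_vector_mult_def cmplx_mat_def
        sum_negf mult.commute)
qed

lemma monom_int_eval_pt:
  "monom_int (eval_pt M k lam \<epsilon>) \<eta> = monom_int \<epsilon> \<eta> * exp_powr (log_pt M k lam) (real_vec \<eta>)"
proof -
  have "eval_pt M k lam \<epsilon> = \<epsilon> * (\<chi> j. exp (log_pt M k lam $ j))"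
    by (simp add: eval_pt_def vec_eq_iff)
  then show ?thesis by (simp add: monom_int_mult monom_int_exp)
qed

text \<open>The old grid points entering a new value at \<open>\<alpha>\<close> are seen from the new grid point. The vector
  \<open>M\<tau> - \<tau>\<close> of the derivative conditions is the effect of the shift parameter on this relation.\<close>

lemma grid_pt_eq:
  fixes M :: "int^'n^'n"
  assumes inv: "invertible (real_mat M)"
  shows "grid_pt M \<tau> k \<beta> = grid_pt M \<tau> (Suc k) \<alpha> -
    Minv_pow M (Suc k) *v (real_vec (\<alpha> - M *v \<beta>) - (real_mat M *v \<tau> - \<tau>))"
proof -
  have "grid_pt M \<tau> k \<beta> = Minv_pow M (Suc k) *v (real_mat M *v (real_vec \<beta> + \<tau>))"
    by (simp add: grid_pt_def Minv_pow_vec_cancel(1)[OF inv])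
  also have "real_mat M *v (real_vec \<beta> + \<tau>) =
      (real_vec \<alpha> + \<tau>) - (real_vec (\<alpha> - M *v \<beta>) - (real_mat M *v \<tau> - \<tau>))"
    by (simp add: real_vec_arith real_mat_vec matrix_vector_right_distrib)
  finally show ?thesis by (simp only: grid_pt_def matrix_vector_mult_diff_distrib)
qed

text \<open>Iterating the invariance under \<open>M\<^bsup>-1\<^esup>\<close> covers the grids of all levels.\<close>

lemma invariant_exponents_affine:
  fixes M :: "int^'n^'n"
  assumes inv: "invariant_exponents M \<Gamma>" and "\<gamma> \<in> \<Gamma>"
  shows "(\<lambda>y. real_monom \<gamma> (x + Minv_pow M k *v y)) \<in> EP \<Gamma> {0}"
proof (induction k)
  case 0
  have "exp_monom \<gamma> 0 = real_monom \<gamma>"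
    by (simp add: fun_eq_iff exp_monom_def real_monom_def exp_powr_def)
  then have "(\<lambda>y. real_monom \<gamma> (y + x)) \<in> EP \<Gamma> {0}"
    using inv exp_monom_in_EP[OF \<open>\<gamma> \<in> \<Gamma>\<close>, of 0] unfolding invariant_exponents_def by auto
  then show ?case by (simp add: Minv_pow_def add.commute)
next
  case (Suc k)
  have "(\<lambda>y. p (matrix_inv (real_mat M) *v y)) \<in> EP \<Gamma> {0}" if "p \<in> EP \<Gamma> {0}" for p
    using inv that unfolding invariant_exponents_def by blast
  from this[OF Suc] show ?case unfolding Minv_pow_def mat_pow_vec funpow_Suc_right by simp
qed

text \<open>With \<open>x\<close> the new grid point and \<open>\<sigma> = M\<tau> - \<tau>\<close>, the old data are a constant times \<open>e\<^bsup>u \<cdot> \<eta>\<^esup> Q(\<eta>)\<close>, where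
  \<open>u\<close> is \<open>log_pt M (k + 1) lam\<close> and \<open>Q(\<eta>)\<close> is the power of \<open>x - M\<^bsup>-(k+1)\<^esup>(\<eta> - \<sigma>)\<close>, a polynomial
  spanned by \<open>\<Gamma>\<close>. The factor \<open>e\<^bsup>u \<cdot> \<eta>\<^esup>\<close> and the character \<open>\<epsilon>\<close> combine to the evaluation point, so the
  conditions annihilate all characters but the trivial one, and that one evaluates \<open>Q\<close> at \<open>\<sigma>\<close>,
  which is the power of \<open>x\<close> itself.\<close>

lemma subdiv_op_reproduces_exp_monom:
  fixes M :: "int^'n^'n"
  assumes inv: "invertible (real_mat M)" and supp: "mask_supported a"
    and \<Gamma>: "invariant_exponents M \<Gamma>" "\<gamma> \<in> \<Gamma>"
    and cond: "\<And>\<gamma> \<epsilon>. \<gamma> \<in> \<Gamma> \<Longrightarrow> \<epsilon> \<in> Xi M \<Longrightarrow>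
           monom_nat (eval_pt M (Suc k) lam \<epsilon>) \<gamma> * multi_deriv \<gamma> (mask_symbol a) (eval_pt M (Suc k) lam \<epsilon>) =
           (if \<epsilon> = 1 then of_int \<bar>det M\<bar> * exp_powr (log_pt M (Suc k) lam) (real_mat M *v \<tau> - \<tau>) *
                 complex_of_real (q_poly \<gamma> (real_mat M *v \<tau> - \<tau>)) else 0)"
  shows "subdiv_op M a (\<lambda>\<beta>. exp_monom \<gamma> lam (grid_pt M \<tau> k \<beta>)) \<alpha> = exp_monom \<gamma> lam (grid_pt M \<tau> (Suc k) \<alpha>)"
proof -
  let ?S = "{\<eta>. a \<eta> \<noteq> 0}" and ?m = "of_int \<bar>det M\<bar> :: complex"
  define A where "A = Minv_pow M (Suc k)"
  define u where "u = log_pt M (Suc k) lam"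
  define \<sigma> where "\<sigma> = real_mat M *v \<tau> - \<tau>"
  define x where "x = grid_pt M \<tau> (Suc k) \<alpha>"
  define Q where "Q y = real_monom \<gamma> (x - A *v (y - \<sigma>))" for y
  define C where "C \<epsilon> = (if \<epsilon> = 1 then ?m * exp_powr u \<sigma> else 0)" for \<epsilon> :: "complex^'n"
  define E where "E = exp_powr lam x * exp_powr (- u) \<sigma>"
  have moment: "(\<Sum>\<eta>\<in>?S. (complex_of_real (a \<eta>) * monom_int (eval_pt M (Suc k) lam \<epsilon>) \<eta>) * Q (real_vec \<eta>)) = C \<epsilon> * Q \<sigma>"
    if \<epsilon>: "\<epsilon> \<in> Xi M" for \<epsilon>
  proof -
    let ?w = "\<lambda>\<eta>. complex_of_real (a \<eta>) * monom_int (eval_pt M (Suc k) lam \<epsilon>) \<eta>"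
    have mono: "(\<Sum>\<eta>\<in>?S. ?w \<eta> * real_monom \<delta> (real_vec \<eta>)) = C \<epsilon> * real_monom \<delta> \<sigma>" if "\<delta> \<in> \<Gamma>" for \<delta>
    proof (rule moments_of_real_monom[where \<Gamma> = \<Gamma>])
      show "\<delta>' \<in> \<Gamma>" if "\<delta>' \<in> box_below \<delta>" for \<delta>'
        using invariant_exponents_downward_closed[OF \<Gamma>(1) \<open>\<delta> \<in> \<Gamma>\<close> that] .
      show "(\<Sum>\<eta>\<in>?S. ?w \<eta> * complex_of_real (q_poly \<delta>' (real_vec \<eta>))) = C \<epsilon> * complex_of_real (q_poly \<delta>' \<sigma>)"
        if "\<delta>' \<in> \<Gamma>" for \<delta>'
        using cond[OF that \<epsilon>] unfolding monom_nat_mult_multi_deriv_symbol[OF supp]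
        by (simp add: C_def u_def \<sigma>_def)
    qed
    obtain T c where T: "finite T" "T \<subseteq> \<Gamma>"
      and c: "\<And>y. real_monom \<gamma> (x + A *v \<sigma> + A *v y) = (\<Sum>\<delta>\<in>T. c \<delta> * real_monom \<delta> y)"
      using invariant_exponents_affine[OF \<Gamma>, of "x + A *v \<sigma>" "Suc k"]
      unfolding A_def by (elim EP_polynomial_cases) blast
    (* The reflection in the definition of Q only changes the signs of coefficients. *)
    define s where "s \<delta> = (-1::complex) ^ (\<Sum>j\<in>UNIV. \<delta> $ j)" for \<delta> :: "nat^'n"
    have neg: "real_monom \<delta> (- y) = s \<delta> * real_monom \<delta> y" for \<delta> y
      by (simp add: real_monom_eq s_def power_sum power_minus[of "complex_of_real _"] prod.distrib)
    have Q: "Q y = (\<Sum>\<delta>\<in>T. c \<delta> * s \<delta> * real_monom \<delta> y)" for y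
    proof -
      have "x - A *v (y - \<sigma>) = x + A *v \<sigma> + A *v (- y)"
        by (simp add: matrix_vector_mult_diff_distrib vec.neg)
      then have "Q y = real_monom \<gamma> (x + A *v \<sigma> + A *v (- y))" by (simp only: Q_def)
      then show ?thesis unfolding c neg by (simp add: mult.assoc)
    qed
    have "(\<Sum>\<eta>\<in>?S. ?w \<eta> * Q (real_vec \<eta>)) =
        (\<Sum>\<delta>\<in>T. c \<delta> * s \<delta> * (\<Sum>\<eta>\<in>?S. ?w \<eta> * real_monom \<delta> (real_vec \<eta>)))"
      unfolding Q sum_distrib_left by (subst sum.swap) (simp add: ac_simps)
    also have "\<dots> = (\<Sum>\<delta>\<in>T. c \<delta> * s \<delta> * (C \<epsilon> * real_monom \<delta> \<sigma>))"
      using T(2) mono by (intro sum.cong) auto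
    also have "\<dots> = C \<epsilon> * Q \<sigma>"
      unfolding Q sum_distrib_left by (simp add: ac_simps)
    finally show ?thesis .
  qed
  have F: "exp_monom \<gamma> lam (grid_pt M \<tau> k \<beta>) =
      E * (exp_powr u (real_vec (\<alpha> - M *v \<beta>)) * Q (real_vec (\<alpha> - M *v \<beta>)))" for \<beta>
  proof -
    let ?\<eta> = "real_vec (\<alpha> - M *v \<beta>)"
    have "exp_powr lam (x - A *v (?\<eta> - \<sigma>)) = exp_powr lam x * exp_powr u (?\<eta> - \<sigma>)"
      unfolding u_def exp_powr_log_pt A_def exp_powr_add[symmetric] by simp
    also have "\<dots> = E * exp_powr u ?\<eta>"
      using exp_powr_add[of u ?\<eta> "- \<sigma>"] by (simp add: E_def exp_powr_minus)
    finally have "exp_powr lam (x - A *v (?\<eta> - \<sigma>)) = E * exp_powr u ?\<eta>" .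
    then show ?thesis
      unfolding grid_pt_eq[OF inv, of \<tau> k \<beta> \<alpha>] \<sigma>_def[symmetric] A_def[symmetric] x_def[symmetric]
      by (simp add: exp_monom_def Q_def real_monom_def)
  qed
  have "?m * subdiv_op M a (\<lambda>\<beta>. exp_monom \<gamma> lam (grid_pt M \<tau> k \<beta>)) \<alpha> =
      (\<Sum>\<epsilon>\<in>Xi M. \<Sum>\<eta>\<in>?S. complex_of_real (a \<eta>) * monom_int \<epsilon> (\<eta> - \<alpha>) *
         (E * (exp_powr u (real_vec \<eta>) * Q (real_vec \<eta>))))"
    by (rule subdiv_op_reindex[OF inv finite_mask_support[OF supp]]) (rule F)
  also have "\<dots> = (\<Sum>\<epsilon>\<in>Xi M. E * monom_int \<epsilon> (- \<alpha>) * (C \<epsilon> * Q \<sigma>))"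
  proof (intro sum.cong refl)
    fix \<epsilon> assume \<epsilon>: "\<epsilon> \<in> Xi M"
    have "monom_int \<epsilon> (\<eta> - \<alpha>) = monom_int \<epsilon> \<eta> * monom_int \<epsilon> (- \<alpha>)" for \<eta>
    proof -
      have "\<epsilon> $ j \<noteq> 0" for j using \<epsilon> by (auto simp: Xi_def)
      then show ?thesis
        by (simp add: monom_int_def power_int_diff power_int_minus divide_inverse prod.distrib)
    qed
    then show "(\<Sum>\<eta>\<in>?S. complex_of_real (a \<eta>) * monom_int \<epsilon> (\<eta> - \<alpha>) *
         (E * (exp_powr u (real_vec \<eta>) * Q (real_vec \<eta>)))) = E * monom_int \<epsilon> (- \<alpha>) * (C \<epsilon> * Q \<sigma>)"
      unfolding moment[OF \<epsilon>, symmetric] monom_int_eval_pt u_def[symmetric] sum_distrib_left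
      by (simp add: ac_simps)
  qed
  also have "\<dots> = (\<Sum>\<epsilon>\<in>Xi M. if \<epsilon> = 1 then E * monom_int 1 (- \<alpha>) * (?m * exp_powr u \<sigma> * Q \<sigma>) else 0)"
    by (intro sum.cong) (auto simp: C_def)
  also have "\<dots> = ?m * (exp_powr lam x * real_monom \<gamma> x)"
  proof -
    have "1 \<in> Xi M" unfolding Xi_eq using Xi_vec_0[of M] by (metis rangeI)
    moreover have "exp_powr (- u) \<sigma> * exp_powr u \<sigma> = 1"
      by (simp add: exp_powr_def sum_negf flip: exp_add)
    ultimately show ?thesis
      using card_Xi(1)[OF inv] by (simp add: E_def Q_def monom_int_def ac_simps)
  qed
  also have "exp_powr lam x * real_monom \<gamma> x = exp_monom \<gamma> lam x"
    by (simp add: exp_monom_def real_monom_def)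
  finally have "?m * subdiv_op M a (\<lambda>\<beta>. exp_monom \<gamma> lam (grid_pt M \<tau> k \<beta>)) \<alpha> = ?m * exp_monom \<gamma> lam x" .
  moreover have "?m \<noteq> 0"
    using inv by (simp add: invertible_det_nz det_real_mat)
  ultimately show ?thesis by (simp add: x_def)
qed

lemma subdiv_op_reproduces_EP:
  fixes M :: "int^'n^'n"
  assumes inv: "invertible (real_mat M)" and supp: "mask_supported a"
    and \<Gamma>: "invariant_exponents M \<Gamma>" and p: "p \<in> EP \<Gamma> \<Lambda>"
    and cond: "\<And>\<gamma> lam \<epsilon>. \<gamma> \<in> \<Gamma> \<Longrightarrow> lam \<in> \<Lambda> \<Longrightarrow> \<epsilon> \<in> Xi M \<Longrightarrow>
           monom_nat (eval_pt M (Suc k) lam \<epsilon>) \<gamma> * multi_deriv \<gamma> (mask_symbol a) (eval_pt M (Suc k) lam \<epsilon>) =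
           (if \<epsilon> = 1 then of_int \<bar>det M\<bar> * exp_powr (log_pt M (Suc k) lam) (real_mat M *v \<tau> - \<tau>) *
                 complex_of_real (q_poly \<gamma> (real_mat M *v \<tau> - \<tau>)) else 0)"
  shows "subdiv_op M a (\<lambda>\<beta>. p (grid_pt M \<tau> k \<beta>)) = (\<lambda>\<alpha>. p (grid_pt M \<tau> (Suc k) \<alpha>))"
proof
  fix \<alpha>
  obtain T c where T: "finite T" "T \<subseteq> \<Gamma> \<times> \<Lambda>"
    and p: "p = (\<lambda>x. \<Sum>(\<gamma>, lam)\<in>T. c (\<gamma>, lam) * exp_monom \<gamma> lam x)"
    using p unfolding EP_def by blast
  have "subdiv_op M a (\<lambda>\<beta>. p (grid_pt M \<tau> k \<beta>)) \<alpha> =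
      (\<Sum>(\<gamma>, lam)\<in>T. c (\<gamma>, lam) * subdiv_op M a (\<lambda>\<beta>. exp_monom \<gamma> lam (grid_pt M \<tau> k \<beta>)) \<alpha>)"
    unfolding p subdiv_op_def case_prod_unfold sum_distrib_left
    by (subst sum.swap) (simp add: ac_simps)
  also have "\<dots> = (\<Sum>(\<gamma>, lam)\<in>T. c (\<gamma>, lam) * exp_monom \<gamma> lam (grid_pt M \<tau> (Suc k) \<alpha>))"
  proof -
    have "subdiv_op M a (\<lambda>\<beta>. exp_monom \<gamma> lam (grid_pt M \<tau> k \<beta>)) \<alpha> = exp_monom \<gamma> lam (grid_pt M \<tau> (Suc k) \<alpha>)"
      if "(\<gamma>, lam) \<in> T" for \<gamma> lam
    proof -
      have mem: "\<gamma> \<in> \<Gamma>" "lam \<in> \<Lambda>" using T that by auto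
      show ?thesis
        by (rule subdiv_op_reproduces_exp_monom[OF inv supp \<Gamma> mem(1) cond[OF _ mem(2)]])
    qed
    then show ?thesis by (intro sum.cong) auto
  qed
  also have "\<dots> = p (grid_pt M \<tau> (Suc k) \<alpha>)" by (simp add: p)
  finally show "subdiv_op M a (\<lambda>\<beta>. p (grid_pt M \<tau> k \<beta>)) \<alpha> = p (grid_pt M \<tau> (Suc k) \<alpha>)" .
qed

section \<open>Convergence of the interpolants\<close>

text \<open>Multilinear interpolation is a convex combination of the data at the vertices of the cell.\<close>

lemma multilinear_minus_bound:
  fixes y :: "real^'n"
  assumes "\<And>\<alpha>. (\<And>j. \<bar>real_of_int (\<alpha> $ j) - y $ j\<bar> \<le> 1) \<Longrightarrow> norm (f \<alpha> - c) \<le> e"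
  shows "norm (multilinear f y - c) \<le> e"
proof -
  define W where "W E = (\<Prod>j\<in>UNIV. if j \<in> E then frac (y $ j) else 1 - frac (y $ j))" for E
  define v where "v E = (\<chi> j. \<lfloor>y $ j\<rfloor> + (if j \<in> E then 1 else 0))" for E
  have W0: "W E \<ge> 0" for E
    unfolding W_def by (intro prod_nonneg) (auto simp: frac_lt_1 less_imp_le)
  have "W E = (\<Prod>j\<in>E. frac (y $ j)) * (\<Prod>j\<in>UNIV - E. 1 - frac (y $ j))" for E
    unfolding W_def by (subst prod.If_cases) (auto simp: Compl_eq_Diff_UNIV)
  then have "(\<Sum>E\<in>UNIV. W E) = (\<Prod>j\<in>UNIV. frac (y $ j) + (1 - frac (y $ j)))"
    by (subst prod_add) auto
  then have W1: "(\<Sum>E\<in>UNIV. W E) = 1" by simp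
  have "multilinear f y - c = (\<Sum>E\<in>UNIV. of_real (W E) * f (v E)) - of_real (\<Sum>E\<in>UNIV. W E) * c"
    unfolding W1 by (simp only: multilinear_def W_def v_def of_real_1 mult_1)
  also have "\<dots> = (\<Sum>E\<in>UNIV. of_real (W E) * (f (v E) - c))"
    by (simp add: sum_distrib_right sum_subtractf right_diff_distrib)
  also have "norm \<dots> \<le> (\<Sum>E\<in>UNIV. W E * e)"
  proof (rule sum_norm_le)
    fix E
    have "\<bar>real_of_int (v E $ j) - y $ j\<bar> \<le> 1" for j
      unfolding v_def by simp linarith
    then have "norm (f (v E) - c) \<le> e" by (rule assms)
    then show "norm (of_real (W E) * (f (v E) - c)) \<le> W E * e"
      using W0[of E] by (simp add: norm_mult mult_left_mono)
  qed
  also have "\<dots> = e" by (simp add: W1 flip: sum_distrib_right)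
  finally show ?thesis .
qed

text \<open>The vertices around \<open>x\<close> differ from \<open>x\<close> by \<open>M\<^bsup>-k\<^esup>\<close> of a bounded vector, so they approach \<open>x\<close>
  uniformly, and uniform continuity of \<open>p\<close> near the compact set applies.\<close>

lemma level_interp_samples_converge:
  fixes M :: "int^'n^'n" and p :: "real^'n \<Rightarrow> complex"
  assumes M: "expanding M" and p: "continuous_on UNIV p"
  shows "converges_cu (\<lambda>k. level_interp M \<tau> k (\<lambda>\<alpha>. p (grid_pt M \<tau> k \<alpha>))) p"
  unfolding converges_cu_def
proof (intro conjI allI impI p uniform_limitI)
  fix K :: "(real^'n) set" and e :: real assume K: "compact K" and e: "e > 0"
  define K' where "K' = {x + d | x d. x \<in> K \<and> d \<in> cball 0 1}"
  have "compact K'" unfolding K'_def using K by (intro compact_sums) auto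
  then have "uniformly_continuous_on K' p"
    using p by (intro compact_uniformly_continuous) (auto intro: continuous_on_subset)
  then obtain d where d: "d > 0" "\<And>x x'. x \<in> K' \<Longrightarrow> x' \<in> K' \<Longrightarrow> dist x' x < d \<Longrightarrow> dist (p x') (p x) < e / 2"
    using e unfolding uniformly_continuous_on_def by (metis half_gt_zero)
  define r where "r k = (\<Sum>j\<in>UNIV. norm (Minv_pow M k *v axis j 1))" for k
  have "r \<longlonglongrightarrow> 0" unfolding r_def
    by (intro tendsto_null_sum tendsto_norm_zero Minv_pow_tendsto_0 M)
  then have "\<forall>\<^sub>F k in sequentially. r k < min d 1"
    using d(1) by (intro order_tendstoD(2)) auto
  then show "\<forall>\<^sub>F k in sequentially. \<forall>x\<in>K. dist (level_interp M \<tau> k (\<lambda>\<alpha>. p (grid_pt M \<tau> k \<alpha>)) x) (p x) < e"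
  proof eventually_elim
    case (elim k)
    show ?case
    proof
      fix x assume x: "x \<in> K"
      define y where "y = mat_pow (real_mat M) k *v x - \<tau>"
      have "norm (multilinear (\<lambda>\<alpha>. p (grid_pt M \<tau> k \<alpha>)) y - p x) \<le> e / 2"
      proof (rule multilinear_minus_bound)
        fix \<alpha> assume \<alpha>: "\<And>j. \<bar>real_of_int (\<alpha> $ j) - y $ j\<bar> \<le> 1"
        have "grid_pt M \<tau> k \<alpha> - x = Minv_pow M k *v (real_vec \<alpha> + \<tau>) - Minv_pow M k *v (mat_pow (real_mat M) k *v x)"
          by (simp add: grid_pt_def Minv_pow_vec_cancel(2)[OF invertible_if_expanding[OF M]])
        also have "\<dots> = Minv_pow M k *v (real_vec \<alpha> - y)"
          unfolding matrix_vector_mult_diff_distrib[symmetric] by (simp add: y_def algebra_simps)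
        also have "\<dots> = (\<Sum>j\<in>UNIV. (real_vec \<alpha> - y) $ j *\<^sub>R (Minv_pow M k *v axis j 1))"
          by (simp only: matrix_mult_sum[of _ "real_vec \<alpha> - y"] matrix_vector_mult_basis scalar_mult_eq_scaleR)
        also have "norm \<dots> \<le> r k"
          unfolding r_def
        proof (rule sum_norm_le)
          fix j show "norm ((real_vec \<alpha> - y) $ j *\<^sub>R (Minv_pow M k *v axis j 1)) \<le> norm (Minv_pow M k *v axis j 1)"
            using \<alpha>[of j] by (simp add: real_vec_arith mult_left_le_one_le)
        qed
        finally have near: "norm (grid_pt M \<tau> k \<alpha> - x) \<le> r k" .
        have "grid_pt M \<tau> k \<alpha> = x + (grid_pt M \<tau> k \<alpha> - x)" "grid_pt M \<tau> k \<alpha> - x \<in> cball 0 1"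
          using near elim by auto
        then have "grid_pt M \<tau> k \<alpha> \<in> K'" using x unfolding K'_def by blast
        moreover have "x = x + 0" "(0 :: real^'n) \<in> cball 0 1" by auto
        then have "x \<in> K'" using x unfolding K'_def by blast
        ultimately have "dist (p (grid_pt M \<tau> k \<alpha>)) (p x) < e / 2"
          using near elim by (intro d(2)) (auto simp: dist_norm)
        then show "norm (p (grid_pt M \<tau> k \<alpha>) - p x) \<le> e / 2" by (simp add: dist_norm)
      qed
      then show "dist (level_interp M \<tau> k (\<lambda>\<alpha>. p (grid_pt M \<tau> k \<alpha>)) x) (p x) < e"
        using e by (simp add: level_interp_def y_def dist_norm)
    qed
  qed
qed

lemma continuous_on_EP:
  assumes "p \<in> EP \<Gamma> \<Lambda>"
  shows "continuous_on UNIV p"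
  using assms unfolding EP_def exp_monom_def monom_nat_def exp_powr_def case_prod_unfold
  by (auto intro!: continuous_intros)

theorem corollary4p8:
  fixes M :: "int^'n^'n"
    and a :: "nat \<Rightarrow> int^'n \<Rightarrow> real"
    and \<Gamma> :: "(nat^'n) set"
    and \<Lambda> :: "(complex^'n) set"
  assumes "expanding M"
    and "\<And>k. mask_supported (a k)"
    and "\<exists>\<tau>. convergent_scheme M a \<tau>"
    and "invariant_exponents M \<Gamma>"
    and "\<exists>\<tau>::real^'n. \<forall>k. \<forall>\<gamma>\<in>\<Gamma>. \<forall>lam\<in>\<Lambda>. \<forall>\<epsilon>\<in>Xi M.
           monom_nat (eval_pt M (k + 1) lam \<epsilon>) \<gamma> *
             multi_deriv \<gamma> (mask_symbol (a k)) (eval_pt M (k + 1) lam \<epsilon>) =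
           (if \<epsilon> = 1
            then of_int \<bar>det M\<bar> *
                 exp_powr (log_pt M (k + 1) lam) (real_mat M *v \<tau> - \<tau>) *
                 complex_of_real (q_poly \<gamma> (real_mat M *v \<tau> - \<tau>))
            else 0)"
  shows "reproduces_EP M a \<Gamma> \<Lambda>"
proof -
  obtain \<tau> where cond: "\<And>k \<gamma> lam \<epsilon>. \<gamma> \<in> \<Gamma> \<Longrightarrow> lam \<in> \<Lambda> \<Longrightarrow> \<epsilon> \<in> Xi M \<Longrightarrow>
      monom_nat (eval_pt M (Suc k) lam \<epsilon>) \<gamma> * multi_deriv \<gamma> (mask_symbol (a k)) (eval_pt M (Suc k) lam \<epsilon>) =
      (if \<epsilon> = 1 then of_int \<bar>det M\<bar> * exp_powr (log_pt M (Suc k) lam) (real_mat M *v \<tau> - \<tau>) *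
            complex_of_real (q_poly \<gamma> (real_mat M *v \<tau> - \<tau>)) else 0)"
    using assms(5) unfolding Suc_eq_plus1 by blast
  have iter: "subdiv_iter M a l k (\<lambda>\<alpha>. p (grid_pt M \<tau> l \<alpha>)) = (\<lambda>\<alpha>. p (grid_pt M \<tau> (l + k) \<alpha>))"
    if p: "p \<in> EP \<Gamma> \<Lambda>" for p l k
  proof (induction k)
    case (Suc k)
    then show ?case
      using subdiv_op_reproduces_EP[OF invertible_if_expanding[OF assms(1)] assms(2,4) p cond]
      by simp
  qed simp
  have "converges_cu (\<lambda>k. level_interp M \<tau> (l + k + 1)
      (subdiv_iter M a l (k + 1) (\<lambda>\<alpha>. p (grid_pt M \<tau> l \<alpha>)))) p"
    if p: "p \<in> EP \<Gamma> \<Lambda>" for p l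
  proof -
    have conv: "converges_cu (\<lambda>k. level_interp M \<tau> k (\<lambda>\<alpha>. p (grid_pt M \<tau> k \<alpha>))) p"
      using continuous_on_EP[OF p] by (rule level_interp_samples_converge[OF assms(1)])
    have "filterlim (\<lambda>k. l + k + 1) sequentially sequentially"
      by (rule filterlim_subseq) (simp add: strict_mono_def)
    with conv show ?thesis
      unfolding iter[OF p] converges_cu_def uniform_limit_iff
      by (auto dest!: spec elim!: eventually_compose_filterlim simp: add.assoc)
  qed
  then show ?thesis unfolding reproduces_EP_def by blast
qed

end
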